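(* Let $n\ge2$ and let $\Omega$ be a bounded $s$-John domain in $\mathbb{R}^n$ with $1\le s<n/(n-1)$. Let $\delta\in(0,n]$, $p\in(\delta/n,\ \delta/(n+s(1-n)))$ and $\kappa\in[0,\ n+s(1-n))$, and put $q=\frac{(\delta-\kappa p)p}{\delta-p(n+s(1-n))}$. Then there is a constant $c$ depending only on $n,\delta,\kappa,p,\Omega$ such that \[ \inf_{b\in\mathbb{R}}\Big(\int_\Omega|u(x)-b|^q\,d\mathcal{H}^{\delta-\kappa p}_\infty\Big)^{1/q}\le c\Big(\int_\Omega|\nabla u(x)|^p\,d\mathcal{H}^{\delta}_\infty\Big)^{1/p} \] for all $u\in C^1(\Omega)$.
   Context: Let $s\ge1$. A bounded domain (open connected set) $\Omega\subset\mathbb{R}^n$ is an $s$-John domain if there are finite positive constants $c_J,C_J$ and a point $x_0\in\Omega$ such that every $x\in\Omega$ can be joined to $x_0$ by a rectifiable curve $\gamma_x:[0,\ell(\gamma_x)]\to\Omega$ parametrised by arc length with $\gamma_x(0)=x$, $\gamma_x(\ell(\gamma_x))=x_0$, $\ell(\gamma_x)\le C_J$, and $\operatorname{dist}(\gamma_x(t),\partial\Omega)\ge c_J t^s$ for all $t\in[0,\ell(\gamma_x)]$. For $E\subset\mathbb{R}^n$ and $\beta\in(0,n]$, $\mathcal{H}^{\beta}_\infty(E)=\inf\{\sum_i r_i^{\beta}: E\subset\bigcup_i B(x_i,r_i)\}$ over countable or finite coverings by open balls. For $f:\Omega\to[0,\infty]$, $\int_\Omega f\,d\mathcal{H}^{\beta}_\infty:=\int_0^\infty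 \mathcal{H}^{\beta}_\infty(\{x\in\Omega: f(x)>t\})\,dt$. *)

theory Defs
  imports "HOL-Analysis.Analysis"
begin

definition curve_length :: "(real \<Rightarrow> 'a::metric_space) \<Rightarrow> real \<Rightarrow> real \<Rightarrow> ennreal" where
  "curve_length \<gamma> a b =
     (SUP tk \<in> {(t, k). t 0 = a \<and> t k = b \<and> (\<forall>i<k. t i \<le> t (Suc i))}.
        ennreal (\<Sum>i<snd tk. dist (\<gamma> (fst tk (Suc i))) (\<gamma> (fst tk i))))"

definition arclength_param :: "(real \<Rightarrow> 'a::metric_space) \<Rightarrow> real \<Rightarrow> bool" where
  "arclength_param \<gamma> l \<longleftrightarrow> 0 \<le> l \<and>
     (\<forall>t1 t2. 0 \<le> t1 \<and> t1 \<le> t2 \<and> t2 \<le> l \<longrightarrow> curve_length \<gamma> t1 t2 = ennreal (t2 - t1))"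

definition s_john_domain :: "real \<Rightarrow> 'a::euclidean_space set \<Rightarrow> bool" where
  "s_john_domain s \<Omega> \<longleftrightarrow> 1 \<le> s \<and> open \<Omega> \<and> connected \<Omega> \<and> bounded \<Omega> \<and>
     (\<exists>cJ CJ x0. 0 < cJ \<and> 0 < CJ \<and> x0 \<in> \<Omega> \<and>
        (\<forall>x\<in>\<Omega>. \<exists>\<gamma> l. arclength_param \<gamma> l \<and> \<gamma> 0 = x \<and> \<gamma> l = x0 \<and> l \<le> CJ \<and>
           (\<forall>t\<in>{0..l}. \<gamma> t \<in> \<Omega> \<and> infdist (\<gamma> t) (frontier \<Omega>) \<ge> cJ * t powr s)))"

text \<open>Hausdorff content H^\<beta>_\<infinity>: infimum over countable (or finite: pad with radius 0,
  i.e. empty balls) coverings by open balls.\<close>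
definition hausdorff_content :: "real \<Rightarrow> 'a::metric_space set \<Rightarrow> ennreal" where
  "hausdorff_content \<beta> E =
     (INF xr \<in> {(x, r). (\<forall>i. 0 \<le> r i) \<and> E \<subseteq> (\<Union>i. ball (x i) (r i))}.
        (\<Sum>i. ennreal (snd xr i powr \<beta>)))"

definition choquet_integral :: "real \<Rightarrow> 'a::metric_space set \<Rightarrow> ('a \<Rightarrow> real) \<Rightarrow> ennreal" where
  "choquet_integral \<beta> \<Omega> f =
     (\<integral>\<^sup>+ t. indicator {0<..} t * hausdorff_content \<beta> {x\<in>\<Omega>. f x > t} \<partial>lborel)"

text \<open>Real power of an extended nonnegative real (exponent a > 0), with \<infinity>^a = \<infinity>.\<close>
definition enn_powr :: "ennreal \<Rightarrow> real \<Rightarrow> ennreal" where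
  "enn_powr x a = (if x = \<infinity> then \<infinity> else ennreal (enn2real x powr a))"

end

theory Submission
  imports Defs
begin

text \<open>
  Put \<open>a = n + s (1 - n)\<close> and \<open>f = |\<nabla>u|\<close>. Averaging \<open>u\<close> over cubes centred on the John curve of \<open>x\<close>, and
  replacing the curve in each dyadic scale by a chain that cannot be shortened, bounds \<open>|u x - b|\<close> by
  \<open>\<Sum>\<^sub>j r\<^sub>j powr (a - n) * \<integral>\<^bsub>B(x, r\<^sub>j)\<^esub> f\<close> with \<open>r\<^sub>j = R / 2^j\<close>.

  Choose coverings of the sets \<open>{f > 2^k}\<close> by balls that almost realise their \<open>\<delta>\<close>-contents. At level \<open>m\<close>
  select, by Vitali's lemma, balls in which for some \<open>k \<ge> m\<close> the \<open>k\<close>-th covering has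
  \<open>\<delta>\<close>-density more than \<open>2 powr ((m - k) p0)\<close>, where \<open>\<delta>/n < p0 < p\<close>. A ball that is not captured by the
  selected ones has \<open>f\<close>-average at most a constant times \<open>2^m\<close>, because \<open>p0 n / \<delta> > 1\<close>; and the selected
  balls satisfy \<open>\<Sum> 2 powr (m p) * \<rho> powr \<delta> \<le> C \<integral> f powr p\<close>, because \<open>p0 < p\<close>. These balls, with
  heights \<open>h\<close> proportional to \<open>2^m\<close>, play the role of a strong type estimate for all fractional maximal functions at once,
  and no subadditivity of the Choquet integral is needed since only suprema of the heights occur.

  Splitting the sum over \<open>j\<close> as in Hedberg's inequality, \<open>|u x - b| powr q > t\<close> forces \<open>x\<close> into one of the balls
  with \<open>M (h \<rho> powr \<kappa>) powr p > t\<close>, and integrating the resulting covers over \<open>t\<close> gives the claim.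
\<close>

subsection \<open>Averages over cubes\<close>

text \<open>Origin of \<open>a\<close>: at distance \<open>t\<close> from \<open>x\<close> along the
  curve, cubes of size about \<open>t powr s\<close> fit into \<open>\<Omega>\<close>, and moving
  one of them by its own size costs \<open>t powr (s (1 - n))\<close> times a local integral of
  \<open>f\<close>. On a ball of radius \<open>t\<close> where \<open>f\<close> has average
  \<open>h\<close> this is about \<open>h * t powr a\<close>. For \<open>s > 1\<close> some
  \<open>t powr (1 - s)\<close> cubes are needed to follow the curve through one dyadic scale;
  adding their integrals is harmless only if the overlap is bounded, whence the shortened chains.

  On the side of the content, working with countable families of weighted balls turns every estimate
  into sums over counting measures, to which Tonelli's theorem applies. A selected ball of radius
  \<rho> that captures \<open>B(x, r)\<close> has \<open>r \<le> \<rho>\<close>; hence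
  \<open>h * r powr e \<le> h * \<rho> powr e\<close> for each \<open>e \<ge> 0\<close>, and one
  family serves all orders \<open>e\<close>. Two orders are used: \<kappa>, and
  \<open>\<delta> / p\<close>, for which one term of the weighted sum already gives a bound.
  Balancing the two over the scales produces the power \<open>p / q\<close>; this is where
  \<open>q\<close> comes from.\<close>

lemma nn_integral_affine_euclidean:
  fixes F :: "'a::euclidean_space \<Rightarrow> ennreal"
  assumes [measurable]: "F \<in> borel_measurable borel" and "c > 0"
  shows "(\<integral>\<^sup>+y. F y \<partial>lborel) = ennreal (c ^ DIM('a)) * (\<integral>\<^sup>+z. F (t + c *\<^sub>R z) \<partial>lborel)"
  using \<open>c > 0\<close>
  by (subst lborel_affine[of c t])
    (auto simp: nn_integral_density nn_integral_distr nn_integral_cmult)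

lemma norm_le_DIM_of_mem_unit_cube:
  fixes z :: "'a::euclidean_space"
  assumes "z \<in> cbox (-One) One"
  shows "norm z \<le> real DIM('a)"
proof -
  have "norm z \<le> (\<Sum>b\<in>Basis. \<bar>z \<bullet> b\<bar>)"
    by (rule norm_le_l1)
  also have "\<dots> \<le> (\<Sum>b\<in>(Basis::'a set). 1)"
    using assms by (intro sum_mono) (auto simp: mem_box abs_le_iff minus_le_iff)
  finally show ?thesis by simp
qed

lemma borel_measurable_indicator_times_continuous_on:
  fixes f :: "'a::euclidean_space \<Rightarrow> real"
  assumes "open \<Omega>" "continuous_on \<Omega> f"
  shows "(\<lambda>y. indicator \<Omega> y * f y) \<in> borel_measurable borel"
  using borel_measurable_continuous_on_indicator[of \<Omega> f] assms by auto

text \<open>The cube lies in the closed ball of radius DIM about 0, so its rescaled copy lies in the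
  open ball of radius \<open>\<rho> * (DIM + 1)\<close>; the substitution contributes the factor
  \<open>\<rho> powr - DIM\<close>.\<close>

lemma integral_unit_cube_le:
  fixes f :: "'a::euclidean_space \<Rightarrow> real" and \<rho> :: real
  assumes "0 < \<rho>" "open \<Omega>" "continuous_on \<Omega> f" "\<And>y. y \<in> \<Omega> \<Longrightarrow> 0 \<le> f y"
    and sub: "ball w (\<rho> * (real DIM('a) + 1)) \<subseteq> \<Omega>"
  shows "ennreal (integral (cbox (-One) One) (\<lambda>z. f (w + \<rho> *\<^sub>R z)))
    \<le> ennreal (\<rho> powr - real DIM('a)) * (\<integral>\<^sup>+y\<in>\<Omega> \<inter> ball w (\<rho> * (real DIM('a) + 1)). ennreal (f y) \<partial>lborel)"
proof -
  define B where "B = ball w (\<rho> * (real DIM('a) + 1))"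
  \<comment> \<open>Extension by 0: \<open>f\<close> is continuous on \<open>\<Omega>\<close> only,
    while the substitution needs a Borel function on the whole space.\<close>
  define h where "h = (\<lambda>y. indicator \<Omega> y * f y)"
  have hm[measurable]: "h \<in> borel_measurable borel"
    unfolding h_def using assms by (intro borel_measurable_indicator_times_continuous_on) auto
  have inB: "w + \<rho> *\<^sub>R z \<in> B" if "z \<in> cbox (-One) One" for z
    using norm_le_DIM_of_mem_unit_cube[OF that] \<open>0 < \<rho>\<close> unfolding B_def
    by (auto simp: dist_norm)
  have [measurable]: "B \<in> sets borel" by (simp add: B_def)
  have BO: "B \<subseteq> \<Omega>" using sub by (simp add: B_def)
  have hnn: "0 \<le> h y" for y using assms by (auto simp: h_def indicator_def)
  define I where "I = integral (cbox (-One) One) (\<lambda>z. f (w + \<rho> *\<^sub>R z))"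
  have "continuous_on (cbox (-One) One) (\<lambda>z. f (w + \<rho> *\<^sub>R z))"
    using inB BO by (intro continuous_on_compose2[OF assms(3)] continuous_intros) auto
  then have "((\<lambda>z. f (w + \<rho> *\<^sub>R z)) has_integral I) (cbox (-One) One)"
    unfolding I_def by (intro integrable_integral integrable_continuous)
  then have "((\<lambda>z. indicator (cbox (-One) One) z * h (w + \<rho> *\<^sub>R z)) has_integral I) (cbox (-One) One)"
    by (rule has_integral_eq[rotated]) (use inB BO in \<open>force simp: h_def\<close>)
  then have "((\<lambda>z. indicator (cbox (-One) One) z * h (w + \<rho> *\<^sub>R z)) has_integral I) UNIV"
    by (rule has_integral_on_superset) auto
  then have "ennreal I = (\<integral>\<^sup>+z. ennreal (indicator (cbox (-One) One) z * h (w + \<rho> *\<^sub>R z)) \<partial>lborel)"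
    using hnn by (intro nn_integral_has_integral_lborel[symmetric]) auto
  also have "\<dots> \<le> (\<integral>\<^sup>+z. ennreal (h (w + \<rho> *\<^sub>R z)) * indicator B (w + \<rho> *\<^sub>R z) \<partial>lborel)"
    using inB by (intro nn_integral_mono) (auto split: split_indicator)
  also have "\<dots> = ennreal (\<rho> powr - real DIM('a)) * (ennreal (\<rho> ^ DIM('a)) * \<dots>)"
    using \<open>0 < \<rho>\<close>
    by (simp add: mult.assoc[symmetric] ennreal_mult[symmetric] powr_minus powr_realpow)
  also have "ennreal (\<rho> ^ DIM('a)) * (\<integral>\<^sup>+z. ennreal (h (w + \<rho> *\<^sub>R z)) * indicator B (w + \<rho> *\<^sub>R z) \<partial>lborel)
     = (\<integral>\<^sup>+y. ennreal (h y) * indicator B y \<partial>lborel)"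
    using \<open>0 < \<rho>\<close> by (intro nn_integral_affine_euclidean[symmetric]) measurable
  also have "\<dots> = (\<integral>\<^sup>+y\<in>\<Omega> \<inter> B. ennreal (f y) \<partial>lborel)"
    by (intro nn_integral_cong) (auto simp: h_def split: split_indicator)
  finally show ?thesis by (simp add: I_def B_def)
qed

text \<open>Not normalised: the cube has volume \<open>2\<^sup>n\<close>.\<close>

definition cube_mean :: "('a::euclidean_space \<Rightarrow> real) \<Rightarrow> 'a \<Rightarrow> real \<Rightarrow> real" where
  "cube_mean u w r = integral (cbox (-One) One) (\<lambda>z. u (w + r *\<^sub>R z))"

text \<open>This replaces a local Poincare inequality. Centre and radius are moved linearly from
  \<open>(w, r)\<close> to \<open>(w', r')\<close> and the mean is differentiated under the
  integral; the velocity of each point of the cube is at most \<open>r + r * DIM\<close>. The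
  intermediate centres stay within \<open>r\<close> of \<open>w\<close>, which explains the radius
  \<open>r * (DIM + 2)\<close>, and the smallest cube on the way gives the weight
  \<open>r' powr - DIM\<close>. Cubes are used because the Leibniz rule is about integrals over a
  \<open>cbox\<close>.\<close>

lemma cube_mean_move:
  fixes u :: "'a::euclidean_space \<Rightarrow> real" and r r' :: real
  assumes der: "\<And>x. x \<in> \<Omega> \<Longrightarrow> (u has_derivative (\<lambda>h. g x \<bullet> h)) (at x)"
    and cg: "continuous_on \<Omega> g" and \<Omega>: "open \<Omega>"
    and r: "0 < r'" "r' \<le> r" and ww: "dist w w' \<le> r"
    and sub: "ball w (r * (real DIM('a) + 2)) \<subseteq> \<Omega>"
  shows "ennreal \<bar>cube_mean u w r - cube_mean u w' r'\<bar>
    \<le> ennreal ((real DIM('a) + 1) * r * r' powr - real DIM('a)) *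
       (\<integral>\<^sup>+y\<in>\<Omega> \<inter> ball w (r * (real DIM('a) + 2)). ennreal (norm (g y)) \<partial>lborel)"
proof -
  define n where "n = real DIM('a)"
  define J where "J = (\<integral>\<^sup>+y\<in>\<Omega> \<inter> ball w (r * (n + 2)). ennreal (norm (g y)) \<partial>lborel)"
  show ?thesis
  proof (cases "J = \<infinity>")
    case True
    then show ?thesis using r by (simp add: J_def n_def ennreal_mult_top)
  next
    case False
    then obtain j where j: "J = ennreal j" "0 \<le> j" by (cases J) auto
    define c where "c = (\<lambda>\<tau>::real. w + \<tau> *\<^sub>R (w' - w))"
    define \<rho> where "\<rho> = (\<lambda>\<tau>::real. r + \<tau> * (r' - r))"
    have \<rho>: "r' \<le> \<rho> \<tau>" "\<rho> \<tau> \<le> r" "0 < \<rho> \<tau>" if "\<tau> \<in> {0..1}" for \<tau>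
    proof -
      have "\<tau> * (r - r') \<le> 1 * (r - r')" "0 \<le> \<tau> * (r - r')"
        using that r by (intro mult_right_mono mult_nonneg_nonneg; simp)+
      then show "r' \<le> \<rho> \<tau>" "\<rho> \<tau> \<le> r" "0 < \<rho> \<tau>"
        using r by (auto simp: \<rho>_def algebra_simps)
    qed
    have cw: "dist w (c \<tau>) \<le> r" if "\<tau> \<in> {0..1}" for \<tau>
    proof -
      have "dist w (c \<tau>) = \<tau> * dist w w'" using that by (simp add: c_def dist_norm norm_minus_commute)
      also have "\<dots> \<le> 1 * r" using that ww r by (intro mult_mono) auto
      finally show ?thesis by simp
    qed
    have bsub: "ball (c \<tau>) (\<rho> \<tau> * (n + 1)) \<subseteq> ball w (r * (n + 2))" if "\<tau> \<in> {0..1}" for \<tau>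
    proof
      fix y assume "y \<in> ball (c \<tau>) (\<rho> \<tau> * (n + 1))"
      then have "dist (c \<tau>) y < \<rho> \<tau> * (n + 1)" by simp
      also have "\<dots> \<le> r * (n + 1)" using \<rho>[OF that] by (intro mult_right_mono) (auto simp: n_def)
      finally have "dist w y < r + r * (n + 1)"
        using cw[OF that] dist_triangle[of w y "c \<tau>"] by linarith
      then show "y \<in> ball w (r * (n + 2))" by (simp add: algebra_simps)
    qed
    have sub': "ball w (r * (n + 2)) \<subseteq> \<Omega>" using sub by (simp add: n_def)
    have inO: "c \<tau> + \<rho> \<tau> *\<^sub>R z \<in> \<Omega>" if "\<tau> \<in> {0..1}" "z \<in> cbox (-One) One" for \<tau> z
    proof -
      have "c \<tau> + \<rho> \<tau> *\<^sub>R z \<in> ball (c \<tau>) (\<rho> \<tau> * (n + 1))"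
        using norm_le_DIM_of_mem_unit_cube[OF that(2)] \<rho>[OF that(1)] by (simp add: dist_norm n_def)
      then show ?thesis using bsub[OF that(1)] sub' by blast
    qed
    have cu: "continuous_on \<Omega> u"
      using der has_derivative_continuous continuous_at_imp_continuous_on by blast
    define fx where "fx = (\<lambda>\<tau> z. g (c \<tau> + \<rho> \<tau> *\<^sub>R z) \<bullet> ((w' - w) + (r' - r) *\<^sub>R z))"
    have cz: "continuous_on (cbox (-One) One) (\<lambda>z. norm (g (c \<tau> + \<rho> \<tau> *\<^sub>R z)))"
      "continuous_on (cbox (-One) One) (\<lambda>z. u (c \<tau> + \<rho> \<tau> *\<^sub>R z))"
      "continuous_on (cbox (-One) One) (fx \<tau>)" if "\<tau> \<in> {0..1}" for \<tau>
      using inO[OF that] unfolding fx_def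
      by (intro continuous_on_norm continuous_on_compose2[OF cg] continuous_on_compose2[OF cu] continuous_intros; force)+
    have D: "((\<lambda>\<tau>. integral (cbox (-One) One) (\<lambda>z. u (c \<tau> + \<rho> \<tau> *\<^sub>R z))) has_field_derivative
        integral (cbox (-One) One) (fx \<tau>)) (at \<tau> within {0..1})" if \<tau>: "\<tau> \<in> {0..1}" for \<tau>
    proof (rule leibniz_rule_field_derivative)
      fix \<tau>' z assume a: "\<tau>' \<in> {0..1::real}" "z \<in> cbox (-One::'a) One"
      have "((\<lambda>\<tau>. c \<tau> + \<rho> \<tau> *\<^sub>R z) has_derivative (\<lambda>h. h *\<^sub>R ((w' - w) + (r' - r) *\<^sub>R z))) (at \<tau>' within {0..1})"
        unfolding c_def \<rho>_def by (auto intro!: derivative_eq_intros simp: algebra_simps)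
      from has_derivative_compose[OF this der[OF inO[OF a]]]
      show "((\<lambda>\<tau>. u (c \<tau> + \<rho> \<tau> *\<^sub>R z)) has_field_derivative fx \<tau>' z) (at \<tau>' within {0..1})"
        by (simp add: fx_def has_field_derivative_def mult_commute_abs)
    next
      fix \<tau>' assume "\<tau>' \<in> {0..1::real}"
      then show "(\<lambda>z. u (c \<tau>' + \<rho> \<tau>' *\<^sub>R z)) integrable_on cbox (-One) One"
        by (intro integrable_continuous cz)
    next
      show "continuous_on ({0..1} \<times> cbox (-One) One) (\<lambda>(\<tau>, z). fx \<tau> z)"
        unfolding fx_def c_def \<rho>_def split_beta
        apply (intro continuous_on_inner continuous_on_compose2[OF cg] continuous_intros)
        using inO unfolding c_def \<rho>_def by force
    qed (use \<tau> in auto)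
    have bd: "norm (integral (cbox (-One) One) (fx \<tau>)) \<le> (n + 1) * r * r' powr - n * j" if \<tau>: "\<tau> \<in> {0..1}" for \<tau>
    proof -
      have "norm (integral (cbox (-One) One) (fx \<tau>))
          \<le> integral (cbox (-One) One) (\<lambda>z. (n + 1) * r * norm (g (c \<tau> + \<rho> \<tau> *\<^sub>R z)))"
      proof (rule integral_norm_bound_integral)
        fix z :: 'a assume z: "z \<in> cbox (-One) One"
        have "norm ((w' - w) + (r' - r) *\<^sub>R z) \<le> norm (w' - w) + \<bar>r' - r\<bar> * norm z"
          by (metis norm_scaleR norm_triangle_ineq)
        also have "\<dots> \<le> r + r * n"
          using ww r norm_le_DIM_of_mem_unit_cube[OF z]
          by (intro add_mono mult_mono) (auto simp: dist_norm norm_minus_commute n_def)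
        finally have "norm ((w' - w) + (r' - r) *\<^sub>R z) \<le> (n + 1) * r" by (simp add: algebra_simps)
        then have "norm (g (c \<tau> + \<rho> \<tau> *\<^sub>R z)) * norm ((w' - w) + (r' - r) *\<^sub>R z)
          \<le> norm (g (c \<tau> + \<rho> \<tau> *\<^sub>R z)) * ((n + 1) * r)" by (rule mult_left_mono) auto
        moreover have "norm (fx \<tau> z) \<le> norm (g (c \<tau> + \<rho> \<tau> *\<^sub>R z)) * norm ((w' - w) + (r' - r) *\<^sub>R z)"
          unfolding fx_def real_norm_def by (rule Cauchy_Schwarz_ineq2)
        ultimately show "norm (fx \<tau> z) \<le> (n + 1) * r * norm (g (c \<tau> + \<rho> \<tau> *\<^sub>R z))"
          by (simp add: mult.commute)
      qed (use cz[OF \<tau>] in \<open>auto intro!: integrable_continuous continuous_intros\<close>)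
      also have "\<dots> = (n + 1) * r * integral (cbox (-One) One) (\<lambda>z. norm (g (c \<tau> + \<rho> \<tau> *\<^sub>R z)))"
        by simp
      also have "integral (cbox (-One) One) (\<lambda>z. norm (g (c \<tau> + \<rho> \<tau> *\<^sub>R z))) \<le> r' powr - n * j"
      proof -
        have "ennreal (integral (cbox (-One) One) (\<lambda>z. norm (g (c \<tau> + \<rho> \<tau> *\<^sub>R z)))) \<le>
          ennreal (\<rho> \<tau> powr - n) * (\<integral>\<^sup>+y\<in>\<Omega> \<inter> ball (c \<tau>) (\<rho> \<tau> * (n + 1)). ennreal (norm (g y)) \<partial>lborel)"
          using \<rho>[OF \<tau>] \<Omega> cg bsub[OF \<tau>] sub' unfolding n_def
          by (intro integral_unit_cube_le continuous_intros) auto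
        also have "\<dots> \<le> ennreal (r' powr - n) * J"
          unfolding J_def using bsub[OF \<tau>] \<rho>[OF \<tau>] r
          by (intro mult_mono nn_integral_mono ennreal_leI powr_mono2') (auto split: split_indicator simp: n_def)
        also have "\<dots> = ennreal (r' powr - n * j)" using j by (simp add: ennreal_mult)
        finally show ?thesis using j by (subst (asm) ennreal_le_iff) auto
      qed
      finally show ?thesis using r by (simp add: n_def mult.assoc mult_left_mono)
    qed
    have "norm (integral (cbox (-One) One) (\<lambda>z. u (c 1 + \<rho> 1 *\<^sub>R z)) - integral (cbox (-One) One) (\<lambda>z. u (c 0 + \<rho> 0 *\<^sub>R z)))
      \<le> (n + 1) * r * r' powr - n * j * norm (1 - 0::real)"
      by (rule field_differentiable_bound[OF _ D bd]) auto
    then have "\<bar>cube_mean u w r - cube_mean u w' r'\<bar> \<le> (n + 1) * r * r' powr - n * j"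
      by (simp add: c_def \<rho>_def cube_mean_def abs_minus_commute)
    then have "ennreal \<bar>cube_mean u w r - cube_mean u w' r'\<bar> \<le> ennreal ((n + 1) * r * r' powr - n * j)"
      by (rule ennreal_leI)
    also have "\<dots> = ennreal ((n + 1) * r * r' powr - n) * J"
      using j r by (simp add: ennreal_mult n_def)
    finally show ?thesis by (simp add: J_def n_def)
  qed
qed

subsection \<open>Chains along curves and the pointwise estimate in John domains\<close>

text \<open>Take a chain in \<open>K\<close> with the least number of steps. If two non-consecutive
  points were within \<open>r\<close> of each other, jumping from one to the other would give a
  shorter chain.\<close>

lemma obtain_separated_chain:
  fixes w :: "nat \<Rightarrow> 'a::metric_space"
  assumes "\<And>i. i \<le> m \<Longrightarrow> w i \<in> K" "\<And>i. i < m \<Longrightarrow> dist (w i) (w (Suc i)) \<le> r"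
  obtains v l where "v 0 = w 0" "v l = w m" "\<And>i. i \<le> l \<Longrightarrow> v i \<in> K"
    "\<And>i. i < l \<Longrightarrow> dist (v i) (v (Suc i)) \<le> r"
    "\<And>i k. i + 2 \<le> k \<Longrightarrow> k \<le> l \<Longrightarrow> r < dist (v i) (v k)"
proof -
  define P where "P = (\<lambda>l. \<exists>v. v 0 = w 0 \<and> v l = w m \<and> (\<forall>i\<le>l. v i \<in> K) \<and> (\<forall>i<l. dist (v i) (v (Suc i)) \<le> r))"
  have "P m" unfolding P_def using assms by blast
  then have "P (LEAST l. P l)" by (rule LeastI)
  then obtain v where v: "v 0 = w 0" "v (LEAST l. P l) = w m" "\<And>i. i \<le> (LEAST l. P l) \<Longrightarrow> v i \<in> K"
    "\<And>i. i < (LEAST l. P l) \<Longrightarrow> dist (v i) (v (Suc i)) \<le> r"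
    unfolding P_def by blast
  define l where "l = (LEAST l. P l)"
  note v = v[folded l_def]
  have "r < dist (v i) (v k)" if ik: "i + 2 \<le> k" "k \<le> l" for i k
  proof (rule ccontr)
    assume "\<not> r < dist (v i) (v k)"
    then have d: "dist (v i) (v k) \<le> r" by simp
    \<comment> \<open>The number of points strictly between \<open>i\<close> and \<open>k\<close>;
      \<open>v'\<close> omits them.\<close>
    define e where "e = k - i - 1"
    have e: "e > 0" "k = i + 1 + e" "e \<le> l" using ik by (auto simp: e_def)
    define v' where "v' = (\<lambda>j. if j \<le> i then v j else v (j + e))"
    have "P (l - e)"
      unfolding P_def
    proof (intro exI[of _ v'] conjI allI impI)
      show "v' 0 = w 0" using v by (simp add: v'_def)
      show "v' (l - e) = w m" using v(2) e ik by (auto simp: v'_def)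
      show "v' j \<in> K" if "j \<le> l - e" for j
        using that e ik v(3)[of j] v(3)[of "j + e"] by (auto simp: v'_def)
      show "dist (v' j) (v' (Suc j)) \<le> r" if "j < l - e" for j
      proof -
        consider "j < i" | "j = i" | "j > i" by linarith
        then show ?thesis
        proof cases
          case 1
          then show ?thesis using v(4)[of j] ik by (simp add: v'_def)
        next
          case 2
          then show ?thesis using d e by (simp add: v'_def)
        next
          case 3
          then show ?thesis using v(4)[of "j + e"] that by (simp add: v'_def)
        qed
      qed
    qed
    then have "l \<le> l - e" unfolding l_def by (rule Least_le)
    then show False using e by simp
  qed
  with v show ?thesis using that by blast
qed

text \<open>Packing by volume: the balls of radius \<open>r / 2\<close> about the points are
  disjoint and lie in the ball of radius \<open>(N + 1/2) * r\<close> about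
  \<open>y\<close>.\<close>

lemma card_separated_in_ball_le:
  fixes f :: "'i \<Rightarrow> 'a::euclidean_space"
  assumes "finite A" "0 < r" "0 \<le> N"
    and sep: "\<And>i k. i \<in> A \<Longrightarrow> k \<in> A \<Longrightarrow> i \<noteq> k \<Longrightarrow> r \<le> dist (f i) (f k)"
    and sub: "\<And>i. i \<in> A \<Longrightarrow> y \<in> ball (f i) (N * r)"
  shows "real (card A) \<le> (2 * N + 1) ^ DIM('a)"
proof -
  define V where "V = unit_ball_vol (real DIM('a))"
  have V: "V > 0" by (simp add: V_def)
  have disj: "disjoint_family_on (\<lambda>i. ball (f i) (r / 2)) A"
    unfolding disjoint_family_on_def
  proof (intro ballI impI)
    fix i k assume ik: "i \<in> A" "k \<in> A" "i \<noteq> k"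
    { fix z assume "dist (f i) z < r / 2" "dist (f k) z < r / 2"
      then have "dist (f i) (f k) < r" using dist_triangle_half_r[of z "f i" r "f k"] by (simp add: dist_commute)
      with sep[OF ik] have False by simp }
    then show "ball (f i) (r / 2) \<inter> ball (f k) (r / 2) = {}" by auto
  qed
  have "ennreal (card A * (V * (r / 2) ^ DIM('a))) = (\<Sum>i\<in>A. emeasure lborel (ball (f i) (r / 2)))"
    using \<open>0 < r\<close> V by (simp add: emeasure_ball V_def ennreal_mult ennreal_of_nat_eq_real_of_nat)
  also have "\<dots> = emeasure lborel (\<Union>i\<in>A. ball (f i) (r / 2))"
    using disj \<open>finite A\<close> by (intro sum_emeasure) auto
  also have "\<dots> \<le> emeasure lborel (ball y ((N + 1/2) * r))"
  proof (rule emeasure_mono)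
    show "(\<Union>i\<in>A. ball (f i) (r / 2)) \<subseteq> ball y ((N + 1/2) * r)"
    proof clarify
      fix i z assume "i \<in> A" "z \<in> ball (f i) (r / 2)"
      then show "z \<in> ball y ((N + 1/2) * r)"
        using sub[of i] dist_triangle[of y z "f i"] by (auto simp: dist_commute algebra_simps)
    qed
  qed auto
  also have "\<dots> = ennreal (V * ((N + 1/2) * r) ^ DIM('a))"
    using \<open>0 < r\<close> \<open>0 \<le> N\<close> by (simp add: emeasure_ball V_def)
  finally have "card A * (V * (r / 2) ^ DIM('a)) \<le> V * ((N + 1/2) * r) ^ DIM('a)"
    using V \<open>0 < r\<close> \<open>0 \<le> N\<close> by (subst (asm) ennreal_le_iff) auto
  also have "(N + 1/2) * r = (2 * N + 1) * (r / 2)" by (simp add: field_simps)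
  finally have "card A * (V * (r / 2) ^ DIM('a)) \<le> (2 * N + 1) ^ DIM('a) * (V * (r / 2) ^ DIM('a))"
    unfolding power_mult_distrib by (simp only: mult_ac)
  moreover have "0 < V * (r / 2) ^ DIM('a)" using V \<open>0 < r\<close> by simp
  ultimately show ?thesis by (rule mult_right_le_imp_le)
qed

text \<open>Consecutive points may be close, so the indices are split by parity: distinct indices of
  equal parity differ by at least 2. This is the factor 2.\<close>

lemma card_separated_chain_in_ball_le:
  fixes v :: "nat \<Rightarrow> 'a::euclidean_space"
  assumes "0 < r" "0 \<le> N"
    and sep: "\<And>i k. i + 2 \<le> k \<Longrightarrow> k \<le> l \<Longrightarrow> r < dist (v i) (v k)"
  shows "real (card {i. i < l \<and> y \<in> ball (v i) (N * r)}) \<le> 2 * (2 * N + 1) ^ DIM('a)"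
proof -
  define A where "A = (\<lambda>e. {i. i < l \<and> y \<in> ball (v i) (N * r) \<and> (even i = e)})"
  have fin: "finite (A e)" for e by (auto simp: A_def)
  have c: "real (card (A e)) \<le> (2 * N + 1) ^ DIM('a)" for e
  proof (rule card_separated_in_ball_le)
    fix i k assume ik: "i \<in> A e" "k \<in> A e" "i \<noteq> k"
    then have "even i = even k" by (auto simp: A_def)
    with ik have "i + 2 \<le> k \<or> k + 2 \<le> i" by presburger
    then show "r \<le> dist (v i) (v k)"
      using sep[of i k] sep[of k i] ik by (auto simp: A_def dist_commute)
  qed (use assms fin in \<open>auto simp: A_def\<close>)
  have "{i. i < l \<and> y \<in> ball (v i) (N * r)} = A True \<union> A False" by (auto simp: A_def)
  then have "card {i. i < l \<and> y \<in> ball (v i) (N * r)} \<le> card (A True) + card (A False)"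
    by (simp add: card_Un_le)
  then show ?thesis using c[of True] c[of False] by linarith
qed

lemma abs_diff_le_sum_abs_diff:
  fixes U :: "nat \<Rightarrow> real"
  shows "ennreal \<bar>U 0 - U N\<bar> \<le> (\<Sum>j<N. ennreal \<bar>U j - U (Suc j)\<bar>)"
proof (induction N)
  case (Suc N)
  have "ennreal \<bar>U 0 - U (Suc N)\<bar> \<le> ennreal (\<bar>U 0 - U N\<bar> + \<bar>U N - U (Suc N)\<bar>)"
    by (intro ennreal_leI) linarith
  also have "\<dots> = ennreal \<bar>U 0 - U N\<bar> + ennreal \<bar>U N - U (Suc N)\<bar>" by simp
  also have "\<dots> \<le> (\<Sum>j<N. ennreal \<bar>U j - U (Suc j)\<bar>) + ennreal \<bar>U N - U (Suc N)\<bar>"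
    by (rule add_right_mono[OF Suc])
  finally show ?case by simp
qed simp

lemma abs_diff_lim_le_suminf_abs_diff:
  fixes U :: "nat \<Rightarrow> real"
  assumes "U \<longlonglongrightarrow> L"
  shows "ennreal \<bar>U 0 - L\<bar> \<le> (\<Sum>j. ennreal \<bar>U j - U (Suc j)\<bar>)"
proof (rule LIMSEQ_le_const2)
  show "(\<lambda>N. ennreal \<bar>U 0 - U N\<bar>) \<longlonglongrightarrow> ennreal \<bar>U 0 - L\<bar>"
    by (intro tendsto_ennrealI tendsto_intros assms)
  show "\<exists>N. \<forall>n\<ge>N. ennreal \<bar>U 0 - U n\<bar> \<le> (\<Sum>j. ennreal \<bar>U j - U (Suc j)\<bar>)"
    using abs_diff_le_sum_abs_diff[of U] sum_le_suminf[of "\<lambda>j. ennreal \<bar>U j - U (Suc j)\<bar>"]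
    by (meson finite_lessThan order_trans summableI zero_le)
qed

text \<open>Walking along a chain that cannot be shortened makes the number of steps near any point
  bounded, so the length of the curve does not enter.\<close>

lemma cube_mean_along_curve:
  fixes u :: "'a::euclidean_space \<Rightarrow> real" and r :: real
  assumes der: "\<And>x. x \<in> \<Omega> \<Longrightarrow> (u has_derivative (\<lambda>h. g x \<bullet> h)) (at x)"
    and cg: "continuous_on \<Omega> g" and \<Omega>: "open \<Omega>" and "0 < r" "a \<le> b" and V: "V \<in> sets borel"
    and lip: "\<And>t t'. t \<in> {a..b} \<Longrightarrow> t' \<in> {a..b} \<Longrightarrow> dist (\<eta> t) (\<eta> t') \<le> \<bar>t - t'\<bar>"
    and sub: "\<And>t. t \<in> {a..b} \<Longrightarrow> ball (\<eta> t) (r * (real DIM('a) + 2)) \<subseteq> \<Omega> \<inter> V"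
  shows "ennreal \<bar>cube_mean u (\<eta> a) r - cube_mean u (\<eta> b) r\<bar>
    \<le> ennreal (2 * (2 * real DIM('a) + 5) ^ DIM('a) * ((real DIM('a) + 1) * r * r powr - real DIM('a))) *
       (\<integral>\<^sup>+y\<in>\<Omega> \<inter> V. ennreal (norm (g y)) \<partial>lborel)"
proof -
  define n where "n = real DIM('a)"
  \<comment> \<open>The number of equal parameter steps that makes consecutive points
    \<open>r\<close>-close; it influences only the initial chain, not the final constant.\<close>
  obtain m' :: nat where m': "(b - a) / r < m'" using reals_Archimedean2 by blast
  define m where "m = Suc m'"
  have m: "m > 0" "(b - a) / r < m" using m' by (auto simp: m_def)
  define \<tau> where "\<tau> = (\<lambda>i. a + real i * ((b - a) / m))"
  have \<tau>: "\<tau> i \<in> {a..b}" if "i \<le> m" for i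
  proof -
    have "real i * ((b - a) / m) \<le> real m * ((b - a) / m)"
      using that \<open>a \<le> b\<close> by (intro mult_right_mono) auto
    then show ?thesis using m \<open>a \<le> b\<close> by (simp add: \<tau>_def)
  qed
  have step: "dist (\<eta> (\<tau> i)) (\<eta> (\<tau> (Suc i))) \<le> r" if "i < m" for i
  proof -
    have "dist (\<eta> (\<tau> i)) (\<eta> (\<tau> (Suc i))) \<le> \<bar>\<tau> i - \<tau> (Suc i)\<bar>"
      using that by (intro lip \<tau>) auto
    also have "\<dots> = (b - a) / m" using \<open>a \<le> b\<close> m by (simp add: \<tau>_def field_simps)
    also have "\<dots> \<le> r" using m \<open>0 < r\<close> by (simp add: field_simps)
    finally show ?thesis .
  qed
  obtain v l where v: "v 0 = \<eta> (\<tau> 0)" "v l = \<eta> (\<tau> m)" "\<And>i. i \<le> l \<Longrightarrow> v i \<in> \<eta> ` {a..b}"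
    "\<And>i. i < l \<Longrightarrow> dist (v i) (v (Suc i)) \<le> r"
    "\<And>i k. i + 2 \<le> k \<Longrightarrow> k \<le> l \<Longrightarrow> r < dist (v i) (v k)"
    by (rule obtain_separated_chain[of m "\<lambda>i. \<eta> (\<tau> i)" "\<eta> ` {a..b}" r]) (use \<tau> step in auto)
  have ends: "v 0 = \<eta> a" "v l = \<eta> b" using v m by (auto simp: \<tau>_def)
  define B where "B = (\<lambda>i. ball (v i) (r * (n + 2)))"
  have B: "B i \<subseteq> \<Omega> \<inter> V" if il: "i \<le> l" for i
  proof -
    obtain t where "t \<in> {a..b}" "v i = \<eta> t" using v(3)[OF il] by blast
    then show ?thesis using sub[of t] by (simp only: B_def n_def)
  qed
  define K where "K = (n + 1) * r * r powr - n"
  have K: "K \<ge> 0" using \<open>0 < r\<close> by (simp add: K_def n_def)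
  \<comment> \<open>The overlap bound of \<open>card_separated_chain_in_ball_le\<close> for balls of
    radius \<open>(n + 2) * r\<close>, where \<open>2 * (n + 2) + 1 = 2 * n + 5\<close>.\<close>
  define N where "N = 2 * (2 * n + 5) ^ DIM('a)"
  have gm: "(\<lambda>y. ennreal (indicator \<Omega> y * norm (g y))) \<in> borel_measurable borel"
    using borel_measurable_indicator_times_continuous_on[OF \<Omega>, of "\<lambda>y. norm (g y)"] cg
    by (auto intro: continuous_intros)
  have Bm[measurable]: "B i \<in> sets borel" for i by (simp add: B_def)
  have eqB: "(\<integral>\<^sup>+y\<in>\<Omega> \<inter> B i. ennreal (norm (g y)) \<partial>lborel)
      = (\<integral>\<^sup>+y. ennreal (indicator \<Omega> y * norm (g y)) * indicator (B i) y \<partial>lborel)" for i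
    by (intro nn_integral_cong) (auto split: split_indicator)
  have "ennreal \<bar>cube_mean u (v 0) r - cube_mean u (v l) r\<bar>
     \<le> (\<Sum>i<l. ennreal \<bar>cube_mean u (v i) r - cube_mean u (v (Suc i)) r\<bar>)"
    using abs_diff_le_sum_abs_diff[of "\<lambda>i. cube_mean u (v i) r" l] .
  also have "\<dots> \<le> (\<Sum>i<l. ennreal K * (\<integral>\<^sup>+y\<in>\<Omega> \<inter> B i. ennreal (norm (g y)) \<partial>lborel))"
    unfolding K_def n_def B_def using \<open>0 < r\<close> v B[unfolded B_def n_def]
    by (intro sum_mono cube_mean_move[OF der cg \<Omega>]) (auto intro: less_imp_le)
  also have "\<dots> = ennreal K * (\<integral>\<^sup>+y. (\<Sum>i<l. ennreal (indicator \<Omega> y * norm (g y)) * indicator (B i) y) \<partial>lborel)"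
    using gm by (subst nn_integral_sum) (auto simp: sum_distrib_left eqB)
  also have "\<dots> \<le> ennreal K * (\<integral>\<^sup>+y. ennreal N * (ennreal (norm (g y)) * indicator (\<Omega> \<inter> V) y) \<partial>lborel)"
  \<comment> \<open>At each \<open>y\<close> the sum counts the chain balls containing
    \<open>y\<close>: there are at most \<open>N\<close>, and none unless \<open>y\<close> is in
    \<open>\<Omega> \<inter> V\<close>.\<close>
  proof (intro mult_left_mono nn_integral_mono)
    fix y
    have "(\<Sum>i<l. ennreal (indicator \<Omega> y * norm (g y)) * indicator (B i) y)
      = ennreal (indicator \<Omega> y * norm (g y)) * of_nat (card {i. i < l \<and> y \<in> B i})"
    proof -
      have "(\<Sum>i<l. indicator (B i) y :: ennreal) = (\<Sum>i\<in>{i. i < l \<and> y \<in> B i}. 1)"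
        by (intro sum.mono_neutral_cong_right) (auto split: split_indicator)
      then show ?thesis by (simp add: sum_distrib_left[symmetric])
    qed
    also have "\<dots> \<le> ennreal (norm (g y)) * indicator (\<Omega> \<inter> V) y * ennreal N"
    proof (cases "{i. i < l \<and> y \<in> B i} = {}")
      case False
      then have "y \<in> \<Omega> \<inter> V" using B by (auto intro: less_imp_le)
      moreover have "real (card {i. i < l \<and> y \<in> B i}) \<le> N"
        using card_separated_chain_in_ball_le[of r "n + 2" l v y] v(5) \<open>0 < r\<close>
        by (simp add: N_def B_def n_def mult.commute algebra_simps)
      ultimately show ?thesis
        by (auto simp: ennreal_of_nat_eq_real_of_nat intro!: mult_left_mono)
    next
      case True
      then show ?thesis by (simp only: card.empty) simp
    qed
    finally show "(\<Sum>i<l. ennreal (indicator \<Omega> y * norm (g y)) * indicator (B i) y)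
        \<le> ennreal N * (ennreal (norm (g y)) * indicator (\<Omega> \<inter> V) y)" by (simp add: mult_ac)
  qed simp
  also have "\<dots> \<le> ennreal K * (ennreal N * (\<integral>\<^sup>+y\<in>\<Omega> \<inter> V. ennreal (norm (g y)) \<partial>lborel))"
  proof (rule mult_left_mono[OF eq_refl])
    have "(\<lambda>y. ennreal (norm (g y)) * indicator (\<Omega> \<inter> V) y)
      = (\<lambda>y. ennreal (indicator \<Omega> y * norm (g y)) * indicator V y)"
      by (auto split: split_indicator)
    then show "(\<integral>\<^sup>+y. ennreal N * (ennreal (norm (g y)) * indicator (\<Omega> \<inter> V) y) \<partial>lborel)
        = ennreal N * (\<integral>\<^sup>+y\<in>\<Omega> \<inter> V. ennreal (norm (g y)) \<partial>lborel)"
      using gm V by (subst nn_integral_cmult) auto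
  qed simp
  also have "\<dots> = ennreal (N * K) * (\<integral>\<^sup>+y\<in>\<Omega> \<inter> V. ennreal (norm (g y)) \<partial>lborel)"
    using K by (simp add: N_def n_def ennreal_mult mult_ac)
  finally show ?thesis by (simp add: ends N_def K_def n_def)
qed

section \<open>John curves and telescoping of cube means\<close>

lemma ball_infdist_frontier_subset:
  fixes z :: "'a::real_normed_vector"
  assumes "z \<in> S"
  shows "ball z (infdist z (frontier S)) \<subseteq> S"
proof (rule ccontr)
  let ?B = "ball z (infdist z (frontier S))"
  assume "\<not> ?B \<subseteq> S"
  then have "?B - S \<noteq> {}" by blast
  \<comment> \<open>A nonempty ball has positive radius, so it contains \<open>z\<close> and meets
    both \<open>S\<close> and its complement; being connected it would meet the frontier. An empty
    frontier has \<open>infdist\<close> 0 and gives the empty ball.\<close>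
  then have "0 < infdist z (frontier S)"
    by (metis ball_eq_empty Diff_empty empty_Diff not_le)
  then have "?B \<inter> S \<noteq> {}" using assms by (metis centre_in_ball disjoint_iff)
  with \<open>?B - S \<noteq> {}\<close> have "?B \<inter> frontier S \<noteq> {}"
    by (intro connected_Int_frontier) auto
  then show False by (metis disjoint_iff infdist_le mem_ball not_le)
qed

lemma arclength_param_dist_le:
  assumes "arclength_param \<gamma> l" "0 \<le> t1" "t1 \<le> t2" "t2 \<le> l"
  shows "dist (\<gamma> t1) (\<gamma> t2) \<le> t2 - t1"
proof -
  \<comment> \<open>The partition with the single step from \<open>t1\<close> to
    \<open>t2\<close>.\<close>
  define p where "p = (\<lambda>i::nat. if i = 0 then t1 else t2, 1::nat)"
  have "ennreal (\<Sum>i<snd p. dist (\<gamma> (fst p (Suc i))) (\<gamma> (fst p i))) \<le> curve_length \<gamma> t1 t2"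
    unfolding curve_length_def by (rule SUP_upper) (use assms in \<open>auto simp: p_def\<close>)
  also have "\<dots> = ennreal (t2 - t1)" using assms by (simp add: arclength_param_def)
  finally show ?thesis using assms by (simp add: p_def dist_commute)
qed

lemma tendsto_cube_mean:
  fixes u :: "'a::euclidean_space \<Rightarrow> real"
  assumes cu: "continuous_on \<Omega> u" and "open \<Omega>" "x \<in> \<Omega>"
    and w: "w \<longlonglongrightarrow> x" and r: "r \<longlonglongrightarrow> 0"
  shows "(\<lambda>j. cube_mean u (w j) (r j)) \<longlonglongrightarrow> 2 ^ DIM('a) * u x"
proof (rule LIMSEQ_I)
  fix e :: real assume "0 < e"
  define n where "n = real DIM('a)"
  define e' where "e' = e / (2 * 2 ^ DIM('a))"
  have "e' > 0" using \<open>0 < e\<close> by (simp add: e'_def)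
  have cont: "isCont u x" using cu \<open>open \<Omega>\<close> \<open>x \<in> \<Omega>\<close> by (simp add: continuous_on_eq_continuous_at)
  then obtain d where d: "d > 0" "\<And>y. dist y x < d \<Longrightarrow> dist (u y) (u x) < e'"
    using \<open>e' > 0\<close> unfolding continuous_at_eps_delta by blast
  obtain d' where d': "d' > 0" "ball x d' \<subseteq> \<Omega>" using \<open>open \<Omega>\<close> \<open>x \<in> \<Omega>\<close> openE by blast
  define D where "D = min d d'"
  have D: "D > 0" "D \<le> d" "D \<le> d'" using d d' by (auto simp: D_def)
  have "(\<lambda>j. dist (w j) x + \<bar>r j\<bar> * n) \<longlonglongrightarrow> 0 + \<bar>0\<bar> * n"
    by (intro tendsto_add tendsto_mult tendsto_rabs tendsto_const r) (use w tendsto_dist_iff in blast)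
  then have "eventually (\<lambda>j. dist (w j) x + \<bar>r j\<bar> * n < D) sequentially"
    using D by (intro order_tendstoD) auto
  then obtain J where J: "\<And>j. j \<ge> J \<Longrightarrow> dist (w j) x + \<bar>r j\<bar> * n < D"
    by (auto simp: eventually_sequentially)
  have "norm (cube_mean u (w j) (r j) - 2 ^ DIM('a) * u x) < e" if "j \<ge> J" for j
  proof -
    have in_ball: "dist (w j + r j *\<^sub>R z) x < D" if "z \<in> cbox (-One) One" for z
    proof -
      have "dist (w j + r j *\<^sub>R z) x \<le> dist (w j) x + \<bar>r j\<bar> * norm z"
        by (metis add.commute add_diff_eq dist_norm norm_scaleR norm_triangle_ineq)
      also have "\<dots> \<le> dist (w j) x + \<bar>r j\<bar> * n"
        using norm_le_DIM_of_mem_unit_cube[OF that] by (simp add: n_def mult_left_mono)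
      finally show ?thesis using J[OF \<open>j \<ge> J\<close>] by simp
    qed
    have cz: "continuous_on (cbox (-One) One) (\<lambda>z. u (w j + r j *\<^sub>R z))"
    proof (rule continuous_on_compose2[OF cu])
      show "(\<lambda>z. w j + r j *\<^sub>R z) ` cbox (-One) One \<subseteq> \<Omega>"
      proof (intro image_subsetI)
        fix z :: 'a assume "z \<in> cbox (-One) One"
        from in_ball[OF this] D d' show "w j + r j *\<^sub>R z \<in> \<Omega>" by (force simp: dist_commute)
      qed
    qed (intro continuous_intros)
    have vol: "measure lborel (cbox (-One) (One::'a)) = 2 ^ DIM('a)"
      by (subst content_cbox) (auto simp: inner_diff_left)
    have "cube_mean u (w j) (r j) - 2 ^ DIM('a) * u x
      = integral (cbox (-One) One) (\<lambda>z. u (w j + r j *\<^sub>R z) - u x)"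
      unfolding cube_mean_def by (subst integral_diff) (auto intro: integrable_continuous cz simp: vol)
    also have "norm \<dots> \<le> integral (cbox (-One) (One::'a)) (\<lambda>z. e')"
      using in_ball D d(2)
      by (intro integral_norm_bound_integral integrable_continuous continuous_intros cz)
        (force simp: dist_real_def intro: less_imp_le)+
    also have "\<dots> = 2 ^ DIM('a) * e'" by (simp add: vol)
    also have "\<dots> < e" using \<open>0 < e\<close> by (simp add: e'_def)
    finally show ?thesis .
  qed
  then show "\<exists>no. \<forall>j\<ge>no. norm (cube_mean u (w j) (r j) - 2 ^ DIM('a) * u x) < e" by blast
qed

text \<open>Cube means are telescoped from \<open>x0\<close> to \<open>x\<close> along the dyadic
  parameters \<open>t j\<close>, with radii \<open>r j\<close> comparable to
  \<open>t j powr s\<close>. The John condition keeps the cubes of stage \<open>j\<close> in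
  \<open>\<Omega>\<close>, the arc length parametrisation keeps them in
  \<open>B(x, R / 2^j)\<close>, and \<open>r j powr (1 - n)\<close> is a constant times
  \<open>(R / 2^j) powr (s * (1 - n))\<close>.\<close>

lemma s_john_pointwise_estimate:
  fixes \<Omega> :: "'a::euclidean_space set"
  defines "n \<equiv> real DIM('a)"
  assumes john: "s_john_domain s \<Omega>"
  obtains C R :: real where "0 < C" "0 < R"
    "\<And>(u::'a \<Rightarrow> real) g. (\<And>x. x \<in> \<Omega> \<Longrightarrow> (u has_derivative (\<lambda>h. g x \<bullet> h)) (at x)) \<Longrightarrow> continuous_on \<Omega> g \<Longrightarrow>
       \<exists>b. \<forall>x\<in>\<Omega>. ennreal \<bar>u x - b\<bar> \<le> ennreal C * (\<Sum>j. ennreal ((R / 2 ^ j) powr (s * (1 - n))) *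
          (\<integral>\<^sup>+y\<in>\<Omega> \<inter> ball x (R / 2 ^ j). ennreal (norm (g y)) \<partial>lborel))"
proof -
  from john obtain cJ T x0 where s: "1 \<le> s" and \<Omega>: "open \<Omega>" and J: "0 < cJ" "0 < T" "x0 \<in> \<Omega>"
    and curve: "\<forall>x\<in>\<Omega>. \<exists>\<gamma> l. arclength_param \<gamma> l \<and> \<gamma> 0 = x \<and> \<gamma> l = x0 \<and> l \<le> T \<and>
           (\<forall>t\<in>{0..l}. \<gamma> t \<in> \<Omega> \<and> infdist (\<gamma> t) (frontier \<Omega>) \<ge> cJ * t powr s)"
    unfolding s_john_domain_def by blast
  obtain e where e: "e > 0" "ball x0 e \<subseteq> \<Omega>" using \<Omega> J openE by blast
  \<comment> \<open>The second entry makes the ball condition hold also where the prolonged curve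
    rests at \<open>x0\<close>: there \<open>c * a powr s \<le> e\<close>.\<close>
  define c where "c = min cJ (e / T powr s)"
  have c: "c > 0" "c \<le> cJ" "c * T powr s \<le> e"
  proof -
    show "c > 0" "c \<le> cJ" using J e by (auto simp: c_def)
    have "c \<le> e / T powr s" by (simp add: c_def)
    then show "c * T powr s \<le> e" using J by (simp add: pos_le_divide_eq)
  qed
  have n: "n > 0" by (simp add: n_def)
  \<comment> \<open>Chosen so that \<open>r j * (n + 2)\<close> is the admissible radius at
    \<open>t (Suc j)\<close>, the worst parameter of the stage from \<open>t (Suc j)\<close> to
    \<open>t j\<close>.\<close>
  define c0 where "c0 = c / (2 powr s * (n + 2))"
  have c0: "c0 > 0" using c n by (simp add: c0_def)
  \<comment> \<open>Chosen so that \<open>t j + r j * (n + 2) \<le> D * t j\<close>, since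
    \<open>t j powr s \<le> t j * T powr (s - 1)\<close>.\<close>
  define D where "D = 1 + c0 * (n + 2) * T powr (s - 1)"
  have D: "D > 0" using c0 n by (simp add: D_def add_pos_nonneg)
  define t where "t = (\<lambda>j::nat. T / 2 ^ j)"
  define r where "r = (\<lambda>j. c0 * t j powr s)"
  have t: "0 < t j" "t j \<le> T" "t (Suc j) = t j / 2" for j
  proof -
    have "T * 1 \<le> T * 2 ^ j" using J by (intro mult_left_mono) auto
    then show "0 < t j" "t j \<le> T" "t (Suc j) = t j / 2" using J by (auto simp: t_def field_simps)
  qed
  have r: "0 < r j" "r (Suc j) = r j / 2 powr s" "r (Suc j) \<le> r j" "r j * (n + 2) = c * t (Suc j) powr s" for j
  proof -
    show "0 < r j" using c0 t(1)[of j] by (simp add: r_def)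
    show "r (Suc j) = r j / 2 powr s" using t(1)[of j] by (simp add: r_def t(3) powr_divide)
    moreover have "1 \<le> (2::real) powr s" using s by (intro ge_one_powr_ge_zero) auto
    then have "r j / 2 powr s \<le> r j / 1" using \<open>0 < r j\<close> by (intro divide_left_mono) auto
    ultimately show "r (Suc j) \<le> r j" by simp
    show "r j * (n + 2) = c * t (Suc j) powr s"
      using t(1)[of j] n by (simp add: r_def c0_def t(3) powr_divide)
  qed
  \<comment> \<open>The first summand pays for moving the centre at fixed radius, the second for
    shrinking the radius; \<open>2 powr (s * n)\<close> is the ratio of
    \<open>r (Suc j) powr - n\<close> to \<open>r j powr - n\<close>.\<close>
  define K1 where "K1 = 2 * (2 * n + 5) ^ DIM('a) * (n + 1) + (n + 1) * 2 powr (s * n)"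
  have K1: "K1 > 0" using n by (simp add: K1_def add_pos_pos)
  define R where "R = D * T"
  \<comment> \<open>Comes from writing \<open>r j\<close> as
    \<open>(c0 / D powr s) * (R / 2^j) powr s\<close>.\<close>
  define K2 where "K2 = (c0 / D powr s) powr (1 - n)"
  have K2: "K2 > 0" using c0 D by (simp add: K2_def)
  have rR: "r j * r j powr - n = K2 * (R / 2 ^ j) powr (s * (1 - n))" for j
  proof -
    have "r j * r j powr - n = r j powr (1 - n)" using r(1)[of j] by (simp add: powr_diff powr_minus field_simps)
    also have "\<dots> = ((c0 / D powr s) * (D * t j) powr s) powr (1 - n)"
      using D t(1)[of j] by (simp add: r_def powr_mult)
    also have "\<dots> = K2 * ((D * t j) powr s) powr (1 - n)"
      using c0 D t(1)[of j] unfolding K2_def by (subst powr_mult) auto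
    also have "\<dots> = K2 * (D * t j) powr (s * (1 - n))" by (simp add: powr_powr)
    finally show ?thesis by (simp add: R_def t_def)
  qed
  have main: "\<exists>b. \<forall>x\<in>\<Omega>. ennreal \<bar>u x - b\<bar> \<le> ennreal (K1 * K2) * (\<Sum>j. ennreal ((R / 2 ^ j) powr (s * (1 - n))) *
          (\<integral>\<^sup>+y\<in>\<Omega> \<inter> ball x (R / 2 ^ j). ennreal (norm (g y)) \<partial>lborel))"
    if der: "\<And>x. x \<in> \<Omega> \<Longrightarrow> (u has_derivative (\<lambda>h. g x \<bullet> h)) (at x)" and cg: "continuous_on \<Omega> g"
    for u :: "'a \<Rightarrow> real" and g
  proof -
    \<comment> \<open>The mean at which every telescoping starts; it does not depend on
      \<open>x\<close>, because all prolonged curves are at \<open>x0\<close> at time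
      \<open>T\<close>. The denominator is the volume of the cube.\<close>
    define b where "b = cube_mean u x0 (r 0) / 2 ^ DIM('a)"
    show ?thesis
    proof (rule exI[of _ b], rule ballI)
      fix x assume x: "x \<in> \<Omega>"
      obtain \<gamma> l where \<gamma>0: "arclength_param \<gamma> l" "\<gamma> 0 = x" "\<gamma> l = x0" "l \<le> T"
        "\<forall>t\<in>{0..l}. \<gamma> t \<in> \<Omega> \<and> infdist (\<gamma> t) (frontier \<Omega>) \<ge> cJ * t powr s"
        using bspec[OF curve x] by (elim exE conjE) (rule that)
      note \<gamma> = \<gamma>0(1-4) bspec[OF \<gamma>0(5)]
      have l: "0 \<le> l" using \<gamma>(1) by (simp add: arclength_param_def)
      \<comment> \<open>The curve waits at \<open>x0\<close> from time \<open>l\<close> to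
        \<open>T\<close>, so that the dyadic parameters are the same for all
        \<open>x\<close>.\<close>
      define \<eta> where "\<eta> = (\<lambda>t. \<gamma> (min t l))"
      have lip0: "dist (\<eta> a) (\<eta> b) \<le> b - a" if "0 \<le> a" "a \<le> b" for a b
        using arclength_param_dist_le[OF \<gamma>(1), of "min a l" "min b l"] that l
        unfolding \<eta>_def by (auto simp: min_def split: if_splits)
      have lip: "dist (\<eta> a) (\<eta> b) \<le> \<bar>a - b\<bar>" if "0 \<le> a" "0 \<le> b" for a b
        using lip0[of a b] lip0[of b a] that by (cases "a \<le> b") (auto simp: dist_commute)
      have \<eta>0: "\<eta> 0 = x" "\<eta> T = x0" using \<gamma> l by (auto simp: \<eta>_def)
      have ball\<eta>: "ball (\<eta> a) (c * a powr s) \<subseteq> \<Omega>" if "0 < a" "a \<le> T" for a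
      proof (cases "a \<le> l")
        case True
        have "c * a powr s \<le> cJ * a powr s" using c by (intro mult_right_mono) auto
        also have "\<dots> \<le> infdist (\<gamma> a) (frontier \<Omega>)" using \<gamma>(5)[of a] that True by simp
        finally have "ball (\<gamma> a) (c * a powr s) \<subseteq> ball (\<gamma> a) (infdist (\<gamma> a) (frontier \<Omega>))"
          by (rule subset_ball)
        also have "\<dots> \<subseteq> \<Omega>" using \<gamma>(5)[of a] that True by (intro ball_infdist_frontier_subset) auto
        finally show ?thesis using True by (simp add: \<eta>_def)
      next
        case False
        have "c * a powr s \<le> c * T powr s" using c that s by (intro mult_left_mono powr_mono2) auto
        also have "\<dots> \<le> e" by (rule c)
        finally have "ball x0 (c * a powr s) \<subseteq> ball x0 e" by (rule subset_ball)
        then show ?thesis using False e \<gamma> by (auto simp: \<eta>_def)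
      qed
      define V where "V = (\<lambda>j. ball x (R / 2 ^ j))"
      have sub: "ball (\<eta> a) (r j * (n + 2)) \<subseteq> \<Omega> \<inter> V j" if a: "a \<in> {t (Suc j)..t j}" for a j
      proof -
        have a0: "0 < a" "a \<le> T" "a \<le> t j" "t (Suc j) \<le> a" using a t(1)[of "Suc j"] t(2)[of j] by auto
        have "r j * (n + 2) \<le> c * a powr s"
          unfolding r(4) using c s t(1)[of "Suc j"] a0 by (intro mult_left_mono powr_mono2) auto
        then have "ball (\<eta> a) (r j * (n + 2)) \<subseteq> ball (\<eta> a) (c * a powr s)" by (rule subset_ball)
        also have "\<dots> \<subseteq> \<Omega>" by (rule ball\<eta>[OF a0(1,2)])
        finally have 1: "ball (\<eta> a) (r j * (n + 2)) \<subseteq> \<Omega>" .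
        have "t j powr s = t j * t j powr (s - 1)" using t(1)[of j] by (simp add: powr_diff)
        also have "\<dots> \<le> t j * T powr (s - 1)"
          using t(1,2)[of j] s by (intro mult_left_mono powr_mono2) auto
        finally have "r j * (n + 2) \<le> c0 * (t j * T powr (s - 1)) * (n + 2)"
          unfolding r_def using c0 n by (intro mult_right_mono mult_left_mono) auto
        then have rj: "t j + r j * (n + 2) \<le> R / 2 ^ j"
          by (simp add: R_def D_def t_def algebra_simps add_divide_distrib)
        have "dist x (\<eta> a) \<le> t j" using lip0[of 0 a] a0 by (simp add: \<eta>0)
        then have "ball (\<eta> a) (r j * (n + 2)) \<subseteq> V j"
          unfolding V_def using rj by (auto simp: ball_subset_ball_iff dist_commute)
        with 1 show ?thesis by blast
      qed
      define I where "I = (\<lambda>j. (\<integral>\<^sup>+y\<in>\<Omega> \<inter> V j. ennreal (norm (g y)) \<partial>lborel))"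
      have stp: "ennreal \<bar>cube_mean u (\<eta> (t j)) (r j) - cube_mean u (\<eta> (t (Suc j))) (r (Suc j))\<bar>
         \<le> ennreal (K1 * (r j * r j powr - n)) * I j" for j
      proof -
        \<comment> \<open>One stage in two moves: from \<open>?A\<close> to \<open>?B\<close> the
          centre travels along the curve, from \<open>?B\<close> to \<open>?C\<close> the radius
          shrinks about a fixed centre.\<close>
        let ?A = "cube_mean u (\<eta> (t j)) (r j)" and ?B = "cube_mean u (\<eta> (t (Suc j))) (r j)"
        let ?C = "cube_mean u (\<eta> (t (Suc j))) (r (Suc j))"
        have tt: "t (Suc j) \<le> t j" using t(1,3)[of j] by simp
        have a: "ennreal \<bar>?B - ?A\<bar> \<le> ennreal (2 * (2 * n + 5) ^ DIM('a) * ((n + 1) * r j * r j powr - n)) * I j"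
          unfolding I_def n_def
        proof (rule cube_mean_along_curve[OF der cg \<Omega>])
          show "V j \<in> sets borel" by (simp add: V_def)
          show "dist (\<eta> a) (\<eta> b) \<le> \<bar>a - b\<bar>" if "a \<in> {t (Suc j)..t j}" "b \<in> {t (Suc j)..t j}" for a b
            using that t(1)[of "Suc j"] by (intro lip) auto
        qed (use r(1) tt sub[unfolded n_def] in auto)
        have b0: "ennreal \<bar>?B - ?C\<bar> \<le> ennreal ((n + 1) * r j * r (Suc j) powr - n) *
           (\<integral>\<^sup>+y\<in>\<Omega> \<inter> ball (\<eta> (t (Suc j))) (r j * (n + 2)). ennreal (norm (g y)) \<partial>lborel)"
          unfolding n_def using r(1,3) sub[of "t (Suc j)" j] tt r(1)[of j]
          by (intro cube_mean_move[OF der cg \<Omega>]) (auto simp: n_def intro: less_imp_le)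
        also have "\<dots> \<le> ennreal ((n + 1) * r j * r (Suc j) powr - n) * I j"
          unfolding I_def using sub[of "t (Suc j)" j] tt
          by (intro mult_left_mono nn_integral_mono) (auto split: split_indicator)
        also have "r (Suc j) powr - n = r j powr - n * 2 powr (s * n)"
          unfolding r(2) using r(1)[of j] by (simp add: powr_divide powr_powr powr_minus field_simps)
        finally have b: "ennreal \<bar>?B - ?C\<bar> \<le> ennreal ((n + 1) * r j * (r j powr - n * 2 powr (s * n))) * I j" .
        have "ennreal \<bar>?A - ?C\<bar> \<le> ennreal (\<bar>?B - ?A\<bar> + \<bar>?B - ?C\<bar>)" by (intro ennreal_leI) linarith
        also have "\<dots> = ennreal \<bar>?B - ?A\<bar> + ennreal \<bar>?B - ?C\<bar>" by simp
        also have "\<dots> \<le> ennreal (2 * (2 * n + 5) ^ DIM('a) * ((n + 1) * r j * r j powr - n)) * I j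
             + ennreal ((n + 1) * r j * (r j powr - n * 2 powr (s * n))) * I j"
          by (intro add_mono a b)
        also have "\<dots> = ennreal (2 * (2 * n + 5) ^ DIM('a) * ((n + 1) * r j * r j powr - n)
             + (n + 1) * r j * (r j powr - n * 2 powr (s * n))) * I j"
          using n r(1)[of j] by (subst ennreal_plus) (auto simp: distrib_right)
        also have "2 * (2 * n + 5) ^ DIM('a) * ((n + 1) * r j * r j powr - n)
             + (n + 1) * r j * (r j powr - n * 2 powr (s * n)) = K1 * (r j * r j powr - n)"
          by (simp add: K1_def algebra_simps)
        finally show ?thesis .
      qed
      define U where "U = (\<lambda>j. cube_mean u (\<eta> (t j)) (r j))"
      have t0: "t \<longlonglongrightarrow> 0"
        unfolding t_def by (rule LIMSEQ_divide_realpow_zero) simp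
      have "U \<longlonglongrightarrow> 2 ^ DIM('a) * u x"
        unfolding U_def
      proof (rule tendsto_cube_mean)
        show "continuous_on \<Omega> u"
          using der has_derivative_continuous continuous_at_imp_continuous_on by blast
        have "(\<lambda>j. dist (\<eta> (t j)) x) \<longlonglongrightarrow> 0"
          by (rule Lim_null_comparison[OF _ t0], rule always_eventually)
            (use lip0[of 0 "t j" for j] t(1) in \<open>auto simp: \<eta>0 dist_commute less_imp_le\<close>)
        then show "(\<lambda>j. \<eta> (t j)) \<longlonglongrightarrow> x" by (simp add: tendsto_dist_iff[of _ x])
        have "r \<longlonglongrightarrow> c0 * 0 powr s"
          unfolding r_def using t0 t(1) s by (intro tendsto_mult tendsto_const tendsto_powr2) (auto intro!: always_eventually less_imp_le)
        then show "r \<longlonglongrightarrow> 0" by simp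
      qed (use \<Omega> x in auto)
      from abs_diff_lim_le_suminf_abs_diff[OF this]
      have "ennreal \<bar>U 0 - 2 ^ DIM('a) * u x\<bar> \<le> (\<Sum>j. ennreal \<bar>U j - U (Suc j)\<bar>)" .
      also have "\<dots> \<le> (\<Sum>j. ennreal (K1 * K2) * (ennreal ((R / 2 ^ j) powr (s * (1 - n))) * I j))"
      proof (intro suminf_le)
        fix j
        have "ennreal \<bar>U j - U (Suc j)\<bar> \<le> ennreal (K1 * (K2 * (R / 2 ^ j) powr (s * (1 - n)))) * I j"
          using stp[of j] unfolding U_def rR .
        also have "\<dots> = ennreal (K1 * K2) * (ennreal ((R / 2 ^ j) powr (s * (1 - n))) * I j)"
          using K1 K2 by (simp add: ennreal_mult mult_ac)
        finally show "ennreal \<bar>U j - U (Suc j)\<bar> \<le> ennreal (K1 * K2) * (ennreal ((R / 2 ^ j) powr (s * (1 - n))) * I j)" .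
      qed auto
      also have "\<dots> = ennreal (K1 * K2) * (\<Sum>j. ennreal ((R / 2 ^ j) powr (s * (1 - n))) * I j)"
        by (rule ennreal_suminf_cmult)
      finally have *: "ennreal \<bar>U 0 - 2 ^ DIM('a) * u x\<bar> \<le> \<dots>" .
      have "u x - b = (2 ^ DIM('a) * u x - U 0) / 2 ^ DIM('a)"
        using \<eta>0 by (simp add: b_def U_def t_def field_simps)
      then have "\<bar>u x - b\<bar> = \<bar>U 0 - 2 ^ DIM('a) * u x\<bar> / 2 ^ DIM('a)" by (simp add: abs_minus_commute)
      also have "\<dots> \<le> \<bar>U 0 - 2 ^ DIM('a) * u x\<bar> / 1"
        by (intro divide_left_mono) auto
      finally have "ennreal \<bar>u x - b\<bar> \<le> ennreal \<bar>U 0 - 2 ^ DIM('a) * u x\<bar>" by (simp add: ennreal_leI)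
      also note *
      finally show "ennreal \<bar>u x - b\<bar> \<le> ennreal (K1 * K2) * (\<Sum>j. ennreal ((R / 2 ^ j) powr (s * (1 - n))) *
            (\<integral>\<^sup>+y\<in>\<Omega> \<inter> ball x (R / 2 ^ j). ennreal (norm (g y)) \<partial>lborel))"
        by (simp add: I_def V_def)
    qed
  qed
  show ?thesis
    by (rule that[of "K1 * K2" R]) (use K1 K2 D J main in \<open>auto simp: R_def\<close>)
qed

subsection \<open>Hausdorff content and Choquet integrals\<close>

lemma nn_integral_count_space_ge_point:
  assumes "i \<in> A"
  shows "F i \<le> (\<integral>\<^sup>+i. F i \<partial>count_space A)"
proof -
  have "F i = (\<integral>\<^sup>+k. F i * indicator {i} k \<partial>count_space A)"
    using assms by (subst nn_integral_cmult_indicator) auto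
  also have "\<dots> \<le> (\<integral>\<^sup>+i. F i \<partial>count_space A)"
    by (intro nn_integral_mono) (auto split: split_indicator)
  finally show ?thesis .
qed

text \<open>Restrict \<open>g\<close> to a set of representatives on which it is injective;
  repetitions only enlarge the right-hand side.\<close>

lemma nn_integral_count_space_image_le:
  "(\<integral>\<^sup>+i. F i \<partial>count_space (g ` A)) \<le> (\<integral>\<^sup>+a. F (g a) \<partial>count_space A)"
proof -
  obtain B where B: "B \<subseteq> A" "inj_on g B" "g ` A = g ` B"
    using subset_image_inj[of "g ` A" g A] by auto
  have "(\<integral>\<^sup>+i. F i \<partial>count_space (g ` A)) = (\<integral>\<^sup>+a. F (g a) \<partial>count_space B)"
    using B by (intro nn_integral_bij_count_space[symmetric]) (auto simp: bij_betw_def)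
  also have "\<dots> \<le> (\<integral>\<^sup>+a. F (g a) \<partial>count_space A)"
    unfolding nn_integral_count_space_indicator[of A] nn_integral_count_space_indicator[of B]
    by (subst (1 2) nn_integral_count_space_indicator)
      (use B in \<open>auto intro!: nn_integral_mono split: split_indicator\<close>)
  finally show ?thesis .
qed

lemma hausdorff_content_mono: "A \<subseteq> B \<Longrightarrow> hausdorff_content \<beta> A \<le> hausdorff_content \<beta> B"
  unfolding hausdorff_content_def by (rule INF_superset_mono) auto

lemma hausdorff_content_le_countable_cover:
  assumes I: "countable I" and "\<And>i. i \<in> I \<Longrightarrow> 0 \<le> \<rho> i" "E \<subseteq> (\<Union>i\<in>I. ball (y i) (\<rho> i))"
  shows "hausdorff_content \<beta> E \<le> (\<integral>\<^sup>+i. ennreal (\<rho> i powr \<beta>) \<partial>count_space I)"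
proof -
  define T where "T = to_nat_on I ` I"
  define x where "x = (\<lambda>k. y (from_nat_into I k))"
  define r where "r = (\<lambda>k. if k \<in> T then \<rho> (from_nat_into I k) else 0)"
  have fn: "from_nat_into I (to_nat_on I i) = i" if "i \<in> I" for i
    using I that by simp
  have "hausdorff_content \<beta> E \<le> (\<Sum>k. ennreal (r k powr \<beta>))"
    unfolding hausdorff_content_def
  proof (rule INF_lower2[of "(x, r)"])
    have "E \<subseteq> (\<Union>k. ball (x k) (r k))"
    proof
      fix e assume "e \<in> E"
      then obtain i where "i \<in> I" "e \<in> ball (y i) (\<rho> i)" using assms by blast
      then have "e \<in> ball (x (to_nat_on I i)) (r (to_nat_on I i))" by (auto simp: x_def r_def T_def fn)
      then show "e \<in> (\<Union>k. ball (x k) (r k))" by blast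
    qed
    then show "(x, r) \<in> {(x, r). (\<forall>i. 0 \<le> r i) \<and> E \<subseteq> (\<Union>i. ball (x i) (r i))}"
      using assms by (auto simp: r_def T_def fn)
  qed simp
  also have "\<dots> = (\<integral>\<^sup>+k. ennreal (r k powr \<beta>) \<partial>count_space UNIV)"
    by (simp add: nn_integral_count_space_nat)
  also have "\<dots> = (\<integral>\<^sup>+k. ennreal (\<rho> (from_nat_into I k) powr \<beta>) \<partial>count_space T)"
    by (subst nn_integral_count_space_indicator)
      (auto intro!: nn_integral_cong simp: r_def split: split_indicator)
  also have "\<dots> = (\<integral>\<^sup>+i. ennreal (\<rho> (from_nat_into I (to_nat_on I i)) powr \<beta>) \<partial>count_space I)"
    unfolding T_def using I
    by (intro nn_integral_bij_count_space[symmetric]) (auto simp: bij_betw_def inj_on_to_nat_on)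
  also have "\<dots> = (\<integral>\<^sup>+i. ennreal (\<rho> i powr \<beta>) \<partial>count_space I)"
    by (intro nn_integral_cong) (simp add: fn)
  finally show ?thesis .
qed

lemma obtain_cover_of_hausdorff_content_less:
  assumes "hausdorff_content \<beta> E < c"
  obtains x r where "\<And>i::nat. 0 \<le> r i" "E \<subseteq> (\<Union>i. ball (x i) (r i))" "(\<Sum>i. ennreal (r i powr \<beta>)) < c"
  using assms unfolding hausdorff_content_def INF_less_iff by auto

section \<open>Dyadic sums and nearly optimal dyadic coverings\<close>

lemma nn_integral_int_geometric:
  fixes \<mu> :: real
  assumes "0 < \<mu>"
  obtains C :: real where "0 < C"
    "\<And>a::int. (\<integral>\<^sup>+k. ennreal (2 powr (- \<mu> * \<bar>real_of_int (k - a)\<bar>)) \<partial>count_space UNIV) \<le> ennreal C"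
proof
  define q :: real where "q = 2 powr - \<mu>"
  have q: "0 < q" "q < 1" using assms by (auto simp: q_def powr_less_one)
  define F where "F = (\<lambda>k::int. ennreal (2 powr (- \<mu> * \<bar>real_of_int k\<bar>)))"
  have F: "F (int i) = ennreal (q ^ i)" "F (- int i) = ennreal (q ^ i)" for i
    by (auto simp: F_def q_def powr_powr[symmetric] powr_realpow[symmetric] powr_powr)
  have S: "(\<Sum>i. ennreal (q ^ i)) = ennreal (1 / (1 - q))"
    using q by (intro suminf_ennreal_eq geometric_sums) auto
  show "0 < 2 / (1 - q)" using q by simp
  fix a :: int
  have "bij (\<lambda>k::int. k - a)" by (rule bij_betw_byWitness[of _ "\<lambda>k. k + a"]) auto
  then have "(\<integral>\<^sup>+k. F (k - a) \<partial>count_space UNIV) = (\<integral>\<^sup>+k. F k \<partial>count_space UNIV)"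
    by (rule nn_integral_bij_count_space)
  also have "\<dots> \<le> (\<integral>\<^sup>+k. F k * indicator (range int) k + F k * indicator (range (\<lambda>i. - int i)) k \<partial>count_space UNIV)"
  proof (intro nn_integral_mono)
    fix k :: int
    have "k \<in> range int \<or> k \<in> range (\<lambda>i. - int i)" by (cases k rule: int_cases2) auto
    then show "F k \<le> F k * indicator (range int) k + F k * indicator (range (\<lambda>i. - int i)) k"
      by (auto split: split_indicator)
  qed
  also have "\<dots> = (\<integral>\<^sup>+k. F k \<partial>count_space (range int)) + (\<integral>\<^sup>+k. F k \<partial>count_space (range (\<lambda>i. - int i)))"
    by (subst nn_integral_add) (auto simp: nn_integral_count_space_indicator)
  also have "\<dots> \<le> (\<integral>\<^sup>+i. F (int i) \<partial>count_space UNIV) + (\<integral>\<^sup>+i. F (- int i) \<partial>count_space UNIV)"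
    by (intro add_mono nn_integral_count_space_image_le)
  also have "\<dots> = ennreal (1 / (1 - q)) + ennreal (1 / (1 - q))"
    by (simp add: F nn_integral_count_space_nat S)
  also have "\<dots> = ennreal (2 / (1 - q))" using q by (subst ennreal_plus[symmetric]) (auto simp: field_simps)
  finally show "(\<integral>\<^sup>+k. ennreal (2 powr (- \<mu> * \<bar>real_of_int (k - a)\<bar>)) \<partial>count_space UNIV) \<le> ennreal (2 / (1 - q))"
    by (simp add: F_def)
qed

text \<open>The intervals \<open>J k\<close> are disjoint, \<open>J k\<close> has length
  \<open>(1 - 2 powr - p) * 2 powr (k * p)\<close>, and for \<open>t\<close> in \<open>J k\<close>
  the set where \<open>f powr p > t\<close> contains the set where \<open>f > 2 powr k\<close>. The
  content as a function of \<open>t\<close> enters only through monotonicity of the integral;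
  Tonelli is applied to multiples of indicators.\<close>

lemma choquet_integral_powr_ge_dyadic:
  fixes \<Omega> :: "'a::metric_space set" and f :: "'a \<Rightarrow> real"
  assumes "0 < p"
  shows "ennreal (1 - 2 powr - p) * (\<integral>\<^sup>+k. ennreal (2 powr (real_of_int k * p)) *
      hausdorff_content \<beta> {x\<in>\<Omega>. f x > 2 powr real_of_int k} \<partial>count_space UNIV)
    \<le> choquet_integral \<beta> \<Omega> (\<lambda>x. f x powr p)"
proof -
  define H where "H = (\<lambda>k::int. hausdorff_content \<beta> {x\<in>\<Omega>. f x > 2 powr real_of_int k})"
  define J where "J = (\<lambda>k::int. {2 powr ((real_of_int k - 1) * p)<..2 powr (real_of_int k * p)} :: real set)"
  have lp: "1 - 2 powr - p \<ge> 0" using assms powr_mono[of "-p" 0 "2::real"] by simp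
  have "ennreal (1 - 2 powr - p) * (\<integral>\<^sup>+k. ennreal (2 powr (real_of_int k * p)) * H k \<partial>count_space UNIV)
     = (\<integral>\<^sup>+k. ennreal (1 - 2 powr - p) * (ennreal (2 powr (real_of_int k * p)) * H k) \<partial>count_space UNIV)"
    by (rule nn_integral_cmult[symmetric]) auto
  also have "\<dots> = (\<integral>\<^sup>+k. (\<integral>\<^sup>+t. H k * indicator (J k) t \<partial>lborel) \<partial>count_space UNIV)"
  proof (intro nn_integral_cong)
    fix k :: int
    have "(real_of_int k - 1) * p \<le> real_of_int k * p" using assms by (simp add: algebra_simps)
    then have "2 powr ((real_of_int k - 1) * p) \<le> 2 powr (real_of_int k * p)" by (intro powr_mono) auto
    then have "(\<integral>\<^sup>+t. H k * indicator (J k) t \<partial>lborel)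
        = H k * ennreal (2 powr (real_of_int k * p) - 2 powr ((real_of_int k - 1) * p))"
      by (subst nn_integral_cmult_indicator) (auto simp: J_def)
    also have "2 powr (real_of_int k * p) - 2 powr ((real_of_int k - 1) * p) = (1 - 2 powr - p) * 2 powr (real_of_int k * p)"
      by (simp add: algebra_simps powr_diff powr_minus field_simps)
    finally show "ennreal (1 - 2 powr - p) * (ennreal (2 powr (real_of_int k * p)) * H k) = (\<integral>\<^sup>+t. H k * indicator (J k) t \<partial>lborel)"
      using lp by (simp add: ennreal_mult mult_ac)
  qed
  also have "\<dots> = (\<integral>\<^sup>+t. (\<integral>\<^sup>+k. H k * indicator (J k) t \<partial>count_space UNIV) \<partial>lborel)"
    by (rule nn_integral_count_space_nn_integral[symmetric]) (auto simp: J_def)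
  also have "\<dots> \<le> choquet_integral \<beta> \<Omega> (\<lambda>x. f x powr p)"
    unfolding choquet_integral_def
  proof (intro nn_integral_mono)
    fix t :: real
    show "(\<integral>\<^sup>+k. H k * indicator (J k) t \<partial>count_space UNIV)
      \<le> indicator {0<..} t * hausdorff_content \<beta> {x \<in> \<Omega>. t < f x powr p}"
    proof (cases "\<exists>k. t \<in> J k")
      case True
      then obtain k0 where k0: "t \<in> J k0" by blast
      have uniq: "k = k0" if "t \<in> J k" for k
      proof -
        have "2 powr ((real_of_int k - 1) * p) < 2 powr (real_of_int k0 * p)"
          "2 powr ((real_of_int k0 - 1) * p) < 2 powr (real_of_int k * p)"
          using k0 that unfolding J_def greaterThanAtMost_iff by (blast intro: less_le_trans)+
        then have "(real_of_int k - 1) * p < real_of_int k0 * p" "(real_of_int k0 - 1) * p < real_of_int k * p"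
          by auto
        then show "k = k0" using \<open>0 < p\<close> by simp
      qed
      have "0 < 2 powr ((real_of_int k0 - 1) * p)" by simp
      also have "\<dots> < t" using k0 by (simp add: J_def)
      finally have t: "0 < t" .
      have "(\<integral>\<^sup>+k. H k * indicator (J k) t \<partial>count_space UNIV) = (\<integral>\<^sup>+k. H k0 * indicator {k0} k \<partial>count_space UNIV)"
      proof (intro nn_integral_cong)
        fix k show "H k * indicator (J k) t = H k0 * indicator {k0} k"
          using uniq[of k] k0 by (cases "k = k0") (auto simp: indicator_def)
      qed
      also have "\<dots> = H k0" by (subst nn_integral_cmult_indicator) auto
      also have "\<dots> \<le> hausdorff_content \<beta> {x \<in> \<Omega>. t < f x powr p}"
        unfolding H_def
      proof (intro hausdorff_content_mono Collect_mono impI conjI)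
        fix x assume x: "x \<in> \<Omega> \<and> 2 powr real_of_int k0 < f x"
        have "t \<le> (2 powr real_of_int k0) powr p" using k0 by (simp add: J_def powr_powr)
        also have "\<dots> < f x powr p" using x \<open>0 < p\<close> by (intro powr_less_mono2) auto
        finally show "t < f x powr p" .
      qed auto
      finally show ?thesis using t by simp
    qed simp
  qed
  finally show ?thesis by (simp add: H_def)
qed

lemma term_le_suminf_ennreal:
  fixes F :: "nat \<Rightarrow> ennreal"
  shows "F i \<le> (\<Sum>i. F i)"
  using sum_le_suminf[of F "{i}"] by simp

text \<open>A real \<open>G\<close> strictly above the integral is positive, which leaves room for
  the errors of the coverings even when the integral vanishes. This is why later estimates are
  stated in terms of \<open>G\<close>.\<close>

lemma obtain_dyadic_covers:
  assumes "0 < p"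
  obtains C :: real where "0 < C"
    "\<And>(\<Omega>::'a::metric_space set) f G \<delta>. choquet_integral \<delta> \<Omega> (\<lambda>x. f x powr p) < ennreal G \<Longrightarrow>
      \<exists>(x :: int \<Rightarrow> nat \<Rightarrow> 'a) \<rho>. (\<forall>k j. 0 \<le> \<rho> k j) \<and>
        (\<forall>k. {x\<in>\<Omega>. f x > 2 powr real_of_int k} \<subseteq> (\<Union>j. ball (x k j) (\<rho> k j))) \<and>
        (\<integral>\<^sup>+k. ennreal (2 powr (real_of_int k * p)) * (\<Sum>j. ennreal (\<rho> k j powr \<delta>)) \<partial>count_space UNIV) \<le> ennreal (C * G)"
proof -
  obtain C0 :: real where C0: "0 < C0"
    "\<And>a::int. (\<integral>\<^sup>+k. ennreal (2 powr (- 1 * \<bar>real_of_int (k - a)\<bar>)) \<partial>count_space UNIV) \<le> ennreal C0"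
    using nn_integral_int_geometric[of 1] by (metis zero_less_one)
  define c1 :: real where "c1 = 1 - 2 powr - p"
  have c1: "0 < c1" using assms powr_less_mono[of "-p" 0 "2::real"] by (simp add: c1_def)
  show ?thesis
  proof (rule that[of "1 / c1 + C0"])
    show "0 < 1 / c1 + C0" using c1 C0 by (simp add: add_pos_pos)
    fix \<Omega> :: "'a set" and f G \<delta>
    assume less: "choquet_integral \<delta> \<Omega> (\<lambda>x. f x powr p) < ennreal G"
    have G: "0 < G" using less by (metis ennreal_neg not_le not_less_zero)
    define H where "H = (\<lambda>k::int. hausdorff_content \<delta> {x\<in>\<Omega>. f x > 2 powr real_of_int k})"
    \<comment> \<open>The error allowed at level \<open>k\<close>: after weighting with
      \<open>2 powr (k * p)\<close> it becomes \<open>G * 2 powr - |k|\<close>, which is summable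
      over all integers.\<close>
    define \<epsilon> where "\<epsilon> = (\<lambda>k::int. G * 2 powr (- (real_of_int k * p)) * 2 powr (- \<bar>real_of_int k\<bar>))"
    have \<epsilon>: "0 < \<epsilon> k" for k using G by (simp add: \<epsilon>_def)
    have "ennreal c1 * (\<integral>\<^sup>+k. ennreal (2 powr (real_of_int k * p)) * H k \<partial>count_space UNIV) \<le> ennreal G"
      using choquet_integral_powr_ge_dyadic[where \<Omega> = \<Omega> and f = f and \<beta> = \<delta>, OF assms] less unfolding c1_def H_def by simp
    then have "ennreal (1 / c1) * (ennreal c1 * (\<integral>\<^sup>+k. ennreal (2 powr (real_of_int k * p)) * H k \<partial>count_space UNIV)) \<le> ennreal (1 / c1) * ennreal G"
      by (rule mult_left_mono) simp
    then have sumH: "(\<integral>\<^sup>+k. ennreal (2 powr (real_of_int k * p)) * H k \<partial>count_space UNIV) \<le> ennreal (1 / c1 * G)"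
      using c1 G by (simp add: mult.assoc[symmetric] ennreal_mult[symmetric])
    have Hfin: "H k < \<infinity>" for k
    proof -
      have "ennreal (2 powr (real_of_int k * p)) * H k \<le> ennreal (1 / c1 * G)"
        using nn_integral_count_space_ge_point[of k UNIV "\<lambda>k. ennreal (2 powr (real_of_int k * p)) * H k"] sumH
        by (meson UNIV_I order_trans)
      then have "ennreal (2 powr (real_of_int k * p)) * H k < \<infinity>"
        by (rule le_less_trans) simp
      then show ?thesis by (auto simp: ennreal_mult_less_top ennreal_mult_eq_top_iff less_top)
    qed
    have ex: "\<forall>k. \<exists>xr. (\<forall>j. 0 \<le> snd xr j) \<and> {x\<in>\<Omega>. f x > 2 powr real_of_int k} \<subseteq> (\<Union>j. ball (fst xr j) (snd xr j)) \<and>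
       (\<Sum>j. ennreal (snd xr j powr \<delta>)) < H k + ennreal (\<epsilon> k)"
    proof
      fix k
      have "H k < H k + ennreal (\<epsilon> k)" using Hfin[of k] \<epsilon>[of k] 
        by (cases "H k") (auto simp: ennreal_plus[symmetric] ennreal_less_iff simp del: ennreal_plus)
      then obtain x r where "\<And>i::nat. 0 \<le> r i" "{x\<in>\<Omega>. f x > 2 powr real_of_int k} \<subseteq> (\<Union>i. ball (x i) (r i))"
        "(\<Sum>i. ennreal (r i powr \<delta>)) < H k + ennreal (\<epsilon> k)"
        unfolding H_def by (rule obtain_cover_of_hausdorff_content_less) blast
      then show "\<exists>xr. (\<forall>j. 0 \<le> snd xr j) \<and> {x\<in>\<Omega>. f x > 2 powr real_of_int k} \<subseteq> (\<Union>j. ball (fst xr j) (snd xr j)) \<and>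
         (\<Sum>j. ennreal (snd xr j powr \<delta>)) < H k + ennreal (\<epsilon> k)"
        by (intro exI[of _ "(x, r)"]) auto
    qed
    obtain xr where "\<forall>k. (\<forall>j. 0 \<le> snd (xr k) j) \<and> {x\<in>\<Omega>. f x > 2 powr real_of_int k} \<subseteq> (\<Union>j. ball (fst (xr k) j) (snd (xr k) j)) \<and>
       (\<Sum>j. ennreal (snd (xr k) j powr \<delta>)) < H k + ennreal (\<epsilon> k)"
      using choice[OF ex] by (elim exE) (rule that)
    then have xr: "\<And>k j. 0 \<le> snd (xr k) j"
      "\<And>k. {x\<in>\<Omega>. f x > 2 powr real_of_int k} \<subseteq> (\<Union>j. ball (fst (xr k) j) (snd (xr k) j))"
      "\<And>k. (\<Sum>j. ennreal (snd (xr k) j powr \<delta>)) < H k + ennreal (\<epsilon> k)"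
      by simp_all
    have "(\<integral>\<^sup>+k. ennreal (2 powr (real_of_int k * p)) * (\<Sum>j. ennreal (snd (xr k) j powr \<delta>)) \<partial>count_space UNIV)
      \<le> (\<integral>\<^sup>+k. ennreal (2 powr (real_of_int k * p)) * H k + ennreal G * ennreal (2 powr (- 1 * \<bar>real_of_int (k - 0)\<bar>)) \<partial>count_space UNIV)"
    proof (intro nn_integral_mono)
      fix k
      have "ennreal (2 powr (real_of_int k * p)) * (\<Sum>j. ennreal (snd (xr k) j powr \<delta>))
        \<le> ennreal (2 powr (real_of_int k * p)) * (H k + ennreal (\<epsilon> k))"
        using xr(3)[of k] by (intro mult_left_mono less_imp_le) auto
      also have "\<dots> = ennreal (2 powr (real_of_int k * p)) * H k + ennreal (2 powr (real_of_int k * p) * \<epsilon> k)"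
        using \<epsilon>[of k] by (simp add: distrib_left ennreal_mult)
      also have "2 powr (real_of_int k * p) * \<epsilon> k = G * 2 powr (- 1 * \<bar>real_of_int (k - 0)\<bar>)"
        by (simp add: \<epsilon>_def powr_minus)
      finally show "ennreal (2 powr (real_of_int k * p)) * (\<Sum>j. ennreal (snd (xr k) j powr \<delta>))
        \<le> ennreal (2 powr (real_of_int k * p)) * H k + ennreal G * ennreal (2 powr (- 1 * \<bar>real_of_int (k - 0)\<bar>))"
        using G by (simp only: ennreal_mult[OF less_imp_le[OF G]] powr_ge_zero)
    qed
    also have "\<dots> = (\<integral>\<^sup>+k. ennreal (2 powr (real_of_int k * p)) * H k \<partial>count_space UNIV)
        + ennreal G * (\<integral>\<^sup>+k. ennreal (2 powr (- 1 * \<bar>real_of_int (k - 0)\<bar>)) \<partial>count_space UNIV)"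
      by (subst nn_integral_add) (auto simp: nn_integral_cmult)
    also have "\<dots> \<le> ennreal (1 / c1 * G) + ennreal G * ennreal C0"
      by (intro add_mono mult_left_mono sumH C0(2)) auto
    also have "\<dots> = ennreal ((1 / c1 + C0) * G)"
      using c1 C0(1) G by (simp add: ennreal_mult[symmetric] ennreal_plus[symmetric] algebra_simps del: ennreal_plus)
    finally show "\<exists>(x :: int \<Rightarrow> nat \<Rightarrow> 'a) \<rho>. (\<forall>k j. 0 \<le> \<rho> k j) \<and>
        (\<forall>k. {x\<in>\<Omega>. f x > 2 powr real_of_int k} \<subseteq> (\<Union>j. ball (x k j) (\<rho> k j))) \<and>
        (\<integral>\<^sup>+k. ennreal (2 powr (real_of_int k * p)) * (\<Sum>j. ennreal (\<rho> k j powr \<delta>)) \<partial>count_space UNIV) \<le> ennreal ((1 / c1 + C0) * G)"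
      using xr by (intro exI[of _ "\<lambda>k. fst (xr k)"] exI[of _ "\<lambda>k. snd (xr k)"]) auto
  qed
qed

section \<open>From coverings to Lebesgue measure and averages\<close>

lemma emeasure_le_of_ball_cover:
  fixes x :: "nat \<Rightarrow> 'a::euclidean_space"
  assumes "0 < \<delta>" "\<delta> \<le> real DIM('a)" "0 \<le> \<tau>" "\<And>j. 0 \<le> \<rho> j"
    and E: "E \<subseteq> (\<Union>j\<in>M. ball (x j) (\<rho> j))"
    and sum: "(\<Sum>j. ennreal (\<rho> j powr \<delta>) * indicator M j) \<le> ennreal \<tau>"
  shows "emeasure lborel E \<le> ennreal (unit_ball_vol (real DIM('a)) * \<tau> powr (real DIM('a) / \<delta>))"
proof -
  define n where "n = real DIM('a)"
  define \<omega> where "\<omega> = unit_ball_vol n"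
  have \<omega>: "0 \<le> \<omega>" by (simp add: \<omega>_def n_def)
  have nd: "0 \<le> n / \<delta> - 1" using assms by (simp add: n_def)
  \<comment> \<open>Since the sum is at most \<tau>, so is each
    \<open>\<rho> j powr \<delta>\<close>; the surplus power \<open>n - \<delta> \<ge> 0\<close> of
    the radius can therefore be traded for a power of \<tau>.\<close>
  have le_term: "\<rho> j powr n \<le> \<rho> j powr \<delta> * \<tau> powr (n / \<delta> - 1)" if "j \<in> M" for j
  proof (cases "\<rho> j = 0")
    case False
    then have pos: "0 < \<rho> j" using assms(4)[of j] by simp
    have "ennreal (\<rho> j powr \<delta>) * indicator M j \<le> (\<Sum>j. ennreal (\<rho> j powr \<delta>) * indicator M j)"
      by (rule term_le_suminf_ennreal)
    also note sum
    finally have le: "\<rho> j powr \<delta> \<le> \<tau>" using that assms(3) by simp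
    have "\<rho> j powr n = \<rho> j powr \<delta> * (\<rho> j powr \<delta>) powr (n / \<delta> - 1)"
      using pos \<open>0 < \<delta>\<close> by (simp add: powr_powr powr_add[symmetric] algebra_simps)
    also have "\<dots> \<le> \<rho> j powr \<delta> * \<tau> powr (n / \<delta> - 1)"
      using le nd by (intro mult_left_mono powr_mono2) auto
    finally show ?thesis .
  qed simp
  have vol: "emeasure lborel (ball (x j) (\<rho> j)) = ennreal (\<omega> * \<rho> j powr n)" for j
    using assms(4)[of j] by (cases "\<rho> j = 0") (auto simp: emeasure_ball \<omega>_def n_def powr_realpow less_le)
  have "emeasure lborel E \<le> emeasure lborel (\<Union>j. if j \<in> M then ball (x j) (\<rho> j) else {})"
  proof (rule emeasure_mono)
    show "E \<subseteq> (\<Union>j. if j \<in> M then ball (x j) (\<rho> j) else {})"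
      using E by (force split: if_splits)
  qed simp
  also have "\<dots> \<le> (\<Sum>j. emeasure lborel (if j \<in> M then ball (x j) (\<rho> j) else {}))"
    by (intro emeasure_subadditive_countably) auto
  also have "\<dots> \<le> (\<Sum>j. ennreal (\<omega> * \<tau> powr (n / \<delta> - 1)) * (ennreal (\<rho> j powr \<delta>) * indicator M j))"
  proof (intro suminf_le)
    fix j
    have "\<omega> * \<rho> j powr n \<le> \<omega> * \<tau> powr (n / \<delta> - 1) * \<rho> j powr \<delta>" if "j \<in> M"
      using mult_left_mono[OF le_term[OF that] \<omega>] by (simp add: mult_ac)
    then show "emeasure lborel (if j \<in> M then ball (x j) (\<rho> j) else {})
        \<le> ennreal (\<omega> * \<tau> powr (n / \<delta> - 1)) * (ennreal (\<rho> j powr \<delta>) * indicator M j)"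
      using \<omega> by (auto simp: vol ennreal_mult[symmetric] intro!: ennreal_leI)
  qed auto
  also have "\<dots> = ennreal (\<omega> * \<tau> powr (n / \<delta> - 1)) * (\<Sum>j. ennreal (\<rho> j powr \<delta>) * indicator M j)"
    by (rule ennreal_suminf_cmult)
  also have "\<dots> \<le> ennreal (\<omega> * \<tau> powr (n / \<delta> - 1)) * ennreal \<tau>"
    by (intro mult_left_mono sum) auto
  also have "\<dots> = ennreal (\<omega> * \<tau> powr (n / \<delta>))"
    using \<open>0 \<le> \<tau>\<close> \<omega> by (cases "\<tau> = 0") (auto simp: ennreal_mult[symmetric] powr_diff)
  finally show ?thesis by (simp add: \<omega>_def n_def)
qed

text \<open>Below height \<open>2 powr m\<close> the function is bounded by that height. A point
  above it is charged to the last dyadic level that it exceeds, which costs at most a factor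
  2.\<close>

lemma nn_integral_le_dyadic_layers:
  fixes f :: "'a::euclidean_space \<Rightarrow> real" and m :: int
  assumes [measurable]: "(\<lambda>y. indicator \<Omega> y * f y) \<in> borel_measurable borel"
    and [measurable]: "B \<in> sets borel"
  shows "(\<integral>\<^sup>+y\<in>\<Omega> \<inter> B. ennreal (f y) \<partial>lborel) \<le> ennreal (2 powr m) * emeasure lborel B +
    (\<Sum>i. ennreal (2 powr (real_of_int m + real i + 1)) * emeasure lborel {y\<in>\<Omega> \<inter> B. f y > 2 powr real_of_int (m + int i)})"
proof -
  define E where "E = (\<lambda>i. {y\<in>\<Omega> \<inter> B. f y > 2 powr real_of_int (m + int i)})"
  have [measurable]: "E i \<in> sets borel" for i
  proof -
    have "E i = {y\<in>B. indicator \<Omega> y * f y > 2 powr real_of_int (m + int i)}"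
    proof (intro set_eqI)
      fix y have "\<not> (0::real) > 2 powr z" for z by (simp add: not_less)
      then show "y \<in> E i \<longleftrightarrow> y \<in> {y\<in>B. indicator \<Omega> y * f y > 2 powr real_of_int (m + int i)}"
        by (cases "y \<in> \<Omega>") (auto simp: E_def)
    qed
    also have "\<dots> \<in> sets borel" by measurable
    finally show ?thesis .
  qed
  have "(\<integral>\<^sup>+y\<in>\<Omega> \<inter> B. ennreal (f y) \<partial>lborel) \<le>
     (\<integral>\<^sup>+y. ennreal (2 powr m) * indicator B y + (\<Sum>i. ennreal (2 powr (real_of_int m + real i + 1)) * indicator (E i) y) \<partial>lborel)"
  proof (intro nn_integral_mono)
    fix y
    show "ennreal (f y) * indicator (\<Omega> \<inter> B) y \<le> ennreal (2 powr m) * indicator B y +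
      (\<Sum>i. ennreal (2 powr (real_of_int m + real i + 1)) * indicator (E i) y)"
    proof (cases "y \<in> \<Omega> \<inter> B")
      case True
      show ?thesis
      proof (cases "f y \<le> 2 powr m")
        case True
        then show ?thesis using \<open>y \<in> \<Omega> \<inter> B\<close> by (intro order_trans[OF _ add_increasing2]) (auto intro: ennreal_leI)
      next
        case False
        obtain i0 :: nat where i0: "f y / 2 powr m < 2 ^ i0" using real_arch_pow[of 2 "f y / 2 powr m"] by auto
        have i0': "f y \<le> 2 powr (real_of_int m + real i0)"
          using i0 by (simp add: powr_add powr_realpow field_simps)
        \<comment> \<open>The least \<open>l\<close> with \<open>P l\<close> is positive in this
          case, and its predecessor is the layer to which \<open>y\<close> is charged.\<close>
        define P where "P = (\<lambda>i::nat. f y \<le> 2 powr (real_of_int m + real i))"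
        define l where "l = (LEAST i. P i)"
        have "P i0" using i0' by (simp add: P_def)
        then have Pl: "P l" unfolding l_def by (rule LeastI)
        have "l \<noteq> 0" using Pl False by (intro notI) (simp add: P_def)
        then obtain i where i: "l = Suc i" by (cases l) auto
        have "\<not> P i" using not_less_Least[of i P] i by (simp add: l_def)
        then have yE: "y \<in> E i" using \<open>y \<in> \<Omega> \<inter> B\<close> by (simp add: P_def E_def)
        have "f y \<le> 2 powr (real_of_int m + real i + 1)" using Pl by (simp add: P_def i add_ac)
        then have "ennreal (f y) * indicator (\<Omega> \<inter> B) y \<le> ennreal (2 powr (real_of_int m + real i + 1)) * indicator (E i) y"
          using yE \<open>y \<in> \<Omega> \<inter> B\<close> by (auto intro: ennreal_leI)
        also have "\<dots> \<le> (\<Sum>i. ennreal (2 powr (real_of_int m + real i + 1)) * indicator (E i) y)"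
          by (rule term_le_suminf_ennreal)
        finally show ?thesis by (simp add: add_increasing)
      qed
    qed simp
  qed
  also have "\<dots> = ennreal (2 powr m) * emeasure lborel B + (\<Sum>i. ennreal (2 powr (real_of_int m + real i + 1)) * emeasure lborel (E i))"
    by (subst nn_integral_add) (auto simp: nn_integral_suminf nn_integral_cmult)
  finally show ?thesis by (simp add: E_def)
qed

subsection \<open>A family of balls replacing the fractional maximal function\<close>

text \<open>Only balls of radius at most \<open>r\<close> are counted: those that touch
  \<open>B(z, r)\<close> lie in \<open>B(z, 3r)\<close>, so disjointness of tripled balls keeps them
  from being counted twice. Larger touching balls are dealt with by doubling.\<close>

definition touching_sum :: "real \<Rightarrow> (nat \<Rightarrow> 'a::metric_space) \<Rightarrow> (nat \<Rightarrow> real) \<Rightarrow> 'a \<Rightarrow> real \<Rightarrow> ennreal" where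
  "touching_sum \<delta> x \<rho> z r =
     (\<Sum>j. ennreal (\<rho> j powr \<delta>) * indicator {j. ball (x j) (\<rho> j) \<inter> ball z r \<noteq> {} \<and> \<rho> j \<le> r} j)"

text \<open>By \<open>big\<close>, \<open>touching_sum\<close> sees every covering ball that meets
  \<open>B(z, r)\<close>. So at level \<open>m + i\<close> the part of the superlevel set in
  \<open>B(z, r)\<close> has measure at most a constant times
  \<open>2 powr (- i * p0 * n / \<delta>) * r powr n\<close>, and against the height
  \<open>2 powr (m + i + 1)\<close> this leaves a geometric series of ratio
  \<open>2 powr (1 - p0 * n / \<delta>) < 1\<close>.\<close>

lemma nn_integral_ball_le_of_sparse_covers:
  fixes f :: "'a::euclidean_space \<Rightarrow> real" and m :: int and x :: "int \<Rightarrow> nat \<Rightarrow> 'a"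
  defines "n \<equiv> real DIM('a)"
  assumes \<delta>: "0 < \<delta>" "\<delta> \<le> n" and p0: "\<delta> / n < p0"
    and fm: "(\<lambda>y. indicator \<Omega> y * f y) \<in> borel_measurable borel"
    and \<rho>: "\<And>k j. 0 \<le> \<rho> k j" and cov: "\<And>k. {y\<in>\<Omega>. f y > 2 powr real_of_int k} \<subseteq> (\<Union>j. ball (x k j) (\<rho> k j))"
    and r: "0 < r"
    and big: "\<And>k j. m \<le> k \<Longrightarrow> ball (x k j) (\<rho> k j) \<inter> ball z r \<noteq> {} \<Longrightarrow> \<rho> k j \<le> r"
    and small: "\<And>k. m \<le> k \<Longrightarrow> touching_sum \<delta> (x k) (\<rho> k) z r \<le> ennreal (2 powr (real_of_int (m - k) * p0) * r powr \<delta>)"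
  shows "(\<integral>\<^sup>+y\<in>\<Omega> \<inter> ball z r. ennreal (f y) \<partial>lborel)
    \<le> ennreal (unit_ball_vol n * (1 + 2 / (1 - 2 powr (1 - p0 * n / \<delta>))) * 2 powr m * r powr n)"
proof -
  define \<omega> where "\<omega> = unit_ball_vol n"
  have \<omega>: "0 \<le> \<omega>" by (simp add: \<omega>_def n_def)
  have n: "0 < n" by (simp add: n_def)
  define q where "q = 2 powr (1 - p0 * n / \<delta>)"
  have "1 < p0 * n / \<delta>" using p0 \<delta> n by (simp add: field_simps)
  then have q: "0 < q" "q < 1" using powr_less_mono[of "1 - p0 * n / \<delta>" 0 "2::real"] by (auto simp: q_def)
  have vB: "emeasure lborel (ball z r) = ennreal (\<omega> * r powr n)"
    using r by (simp add: emeasure_ball \<omega>_def n_def powr_realpow)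
  have E: "emeasure lborel {y\<in>\<Omega> \<inter> ball z r. f y > 2 powr real_of_int (m + int i)}
      \<le> ennreal (\<omega> * (2 powr (- (real i * (p0 * n / \<delta>))) * r powr n))" for i
  proof -
    define k where "k = m + int i"
    define M where "M = {j. ball (x k j) (\<rho> k j) \<inter> ball z r \<noteq> {} \<and> \<rho> k j \<le> r}"
    define \<tau> where "\<tau> = 2 powr (- (real i * p0)) * r powr \<delta>"
    have "emeasure lborel {y\<in>\<Omega> \<inter> ball z r. f y > 2 powr real_of_int k}
      \<le> ennreal (unit_ball_vol (real DIM('a)) * \<tau> powr (real DIM('a) / \<delta>))"
    proof (rule emeasure_le_of_ball_cover[where M = M and x = "x k" and \<rho> = "\<rho> k"])
      show "{y \<in> \<Omega> \<inter> ball z r. 2 powr real_of_int k < f y} \<subseteq> (\<Union>j\<in>M. ball (x k j) (\<rho> k j))"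
      proof
        fix y assume y: "y \<in> {y \<in> \<Omega> \<inter> ball z r. 2 powr real_of_int k < f y}"
        then obtain j where j: "y \<in> ball (x k j) (\<rho> k j)" using cov[of k] by blast
        then have "ball (x k j) (\<rho> k j) \<inter> ball z r \<noteq> {}" using y by blast
        then have "j \<in> M" using big[of k j] by (simp add: M_def k_def)
        with j show "y \<in> (\<Union>j\<in>M. ball (x k j) (\<rho> k j))" by blast
      qed
      show "(\<Sum>j. ennreal (\<rho> k j powr \<delta>) * indicator M j) \<le> ennreal \<tau>"
        using small[of k] by (simp add: touching_sum_def M_def \<tau>_def k_def)
    qed (use \<delta> \<rho> in \<open>auto simp: n_def \<tau>_def\<close>)
    also have "\<tau> powr (real DIM('a) / \<delta>) = 2 powr (- (real i * (p0 * n / \<delta>))) * r powr n"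
      using \<delta> r by (simp add: \<tau>_def powr_mult powr_powr n_def mult.assoc)
    finally show ?thesis by (simp add: \<omega>_def n_def k_def)
  qed
  have "(\<integral>\<^sup>+y\<in>\<Omega> \<inter> ball z r. ennreal (f y) \<partial>lborel) \<le> ennreal (2 powr m) * emeasure lborel (ball z r) +
    (\<Sum>i. ennreal (2 powr (real_of_int m + real i + 1)) * emeasure lborel {y\<in>\<Omega> \<inter> ball z r. f y > 2 powr real_of_int (m + int i)})"
    by (rule nn_integral_le_dyadic_layers[OF fm]) auto
  also have "\<dots> \<le> ennreal (2 powr m * (\<omega> * r powr n)) + (\<Sum>i. ennreal (2 * 2 powr m * \<omega> * r powr n) * ennreal (q ^ i))"
  proof (intro add_mono suminf_le)
    fix i
    have "ennreal (2 powr (real_of_int m + real i + 1)) * emeasure lborel {y\<in>\<Omega> \<inter> ball z r. f y > 2 powr real_of_int (m + int i)}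
       \<le> ennreal (2 powr (real_of_int m + real i + 1)) * ennreal (\<omega> * (2 powr (- (real i * (p0 * n / \<delta>))) * r powr n))"
      by (intro mult_left_mono E) auto
    also have "\<dots> = ennreal (2 powr (real_of_int m + real i + 1) * (\<omega> * (2 powr (- (real i * (p0 * n / \<delta>))) * r powr n)))"
      using \<omega> by (simp add: ennreal_mult)
    also have "2 powr (real_of_int m + real i + 1) * (\<omega> * (2 powr (- (real i * (p0 * n / \<delta>))) * r powr n))
      = 2 * 2 powr m * \<omega> * r powr n * (2 powr real i * 2 powr (- (real i * (p0 * n / \<delta>))))"
    proof -
      have "2 powr (real_of_int m + real i + 1) = 2 * 2 powr m * 2 powr real i" by (simp add: powr_add)
      then show ?thesis by (simp only: mult_ac)
    qed
    also have "2 powr real i * 2 powr (- (real i * (p0 * n / \<delta>))) = q ^ i"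
    proof -
      have "real i + - (real i * (p0 * n / \<delta>)) = (1 - p0 * n / \<delta>) * real i" by (simp add: algebra_simps)
      then show ?thesis using q unfolding q_def powr_add[symmetric] by (simp add: powr_realpow[symmetric] powr_powr)
    qed
    also have "ennreal (2 * 2 powr m * \<omega> * r powr n * q ^ i) = ennreal (2 * 2 powr m * \<omega> * r powr n) * ennreal (q ^ i)"
      using \<omega> q by (simp add: ennreal_mult)
    finally show "ennreal (2 powr (real_of_int m + real i + 1)) * emeasure lborel {y\<in>\<Omega> \<inter> ball z r. f y > 2 powr real_of_int (m + int i)}
       \<le> ennreal (2 * 2 powr m * \<omega> * r powr n) * ennreal (q ^ i)" .
  qed (use \<omega> in \<open>auto simp: vB ennreal_mult\<close>)
  also have "(\<Sum>i. ennreal (2 * 2 powr m * \<omega> * r powr n) * ennreal (q ^ i)) = ennreal (2 * 2 powr m * \<omega> * r powr n) * ennreal (1 / (1 - q))"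
  proof -
    have "(\<Sum>i. ennreal (q ^ i)) = ennreal (1 / (1 - q))"
      using q by (intro suminf_ennreal_eq geometric_sums) auto
    then show ?thesis by simp
  qed
  also have "\<dots> = ennreal (2 * 2 powr m * \<omega> * r powr n * (1 / (1 - q)))"
    using q \<omega> by (subst ennreal_mult[symmetric]) auto
  also have "ennreal (2 powr m * (\<omega> * r powr n)) + \<dots> = ennreal (2 powr m * (\<omega> * r powr n) + 2 * 2 powr m * \<omega> * r powr n * (1 / (1 - q)))"
    using q \<omega> by (subst ennreal_plus) auto
  also have "2 powr m * (\<omega> * r powr n) + 2 * 2 powr m * \<omega> * r powr n * (1 / (1 - q)) = \<omega> * (1 + 2 / (1 - q)) * 2 powr m * r powr n"
    by (simp add: algebra_simps)
  finally show ?thesis by (simp add: \<omega>_def q_def)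
qed

text \<open>\<open>X\<close> holds the balls that are too dense at some level
  \<open>k \<ge> m\<close>. Vitali's lemma is applied to their triples, hence
  \<open>15 = 5 * 3\<close>. The mass making a selected ball dense lies inside its triple; as the
  triples are disjoint, each covering ball is charged at most once. The factor
  \<open>2 powr ((k - m) * p0)\<close> inverts the density threshold. The bound \<open>R\<close>
  keeps the radii bounded, as Vitali's lemma requires.\<close>

lemma obtain_vitali_selection:
  fixes x :: "int \<Rightarrow> nat \<Rightarrow> 'a::euclidean_space" and \<rho> :: "int \<Rightarrow> nat \<Rightarrow> real"
    and m :: int and R p0 \<delta> :: real
  defines "X \<equiv> {(z, r). 0 < r \<and> r \<le> R \<and> (\<exists>k\<ge>m. ennreal (2 powr (real_of_int (m - k) * p0) * r powr \<delta>) < touching_sum \<delta> (x k) (\<rho> k) z r)}"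
  obtains V where "countable V" "V \<subseteq> X"
    "\<And>z r. (z, r) \<in> X \<Longrightarrow> \<exists>(z', r')\<in>V. z \<in> ball z' (15 * r') \<and> r \<le> 15 * r'"
    "(\<integral>\<^sup>+v. ennreal (snd v powr \<delta>) \<partial>count_space V) \<le>
      (\<integral>\<^sup>+k. indicator {m..} k * ennreal (2 powr (real_of_int (k - m) * p0)) * (\<Sum>j. ennreal (\<rho> k j powr \<delta>)) \<partial>count_space UNIV)"
proof -
  have X3: "0 < 3 * snd v \<and> 3 * snd v \<le> 3 * R" if "v \<in> X" for v using that by (auto simp: X_def)
  obtain V where V: "countable V" "V \<subseteq> X"
    and disj: "pairwise (\<lambda>i j. disjnt (cball (fst i) (3 * snd i)) (cball (fst j) (3 * snd j))) V"
    and cov: "\<And>i. i \<in> X \<Longrightarrow> \<exists>j. j \<in> V \<and> \<not> disjnt (cball (fst i) (3 * snd i)) (cball (fst j) (3 * snd j)) \<and>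
                        cball (fst i) (3 * snd i) \<subseteq> ball (fst j) (5 * (3 * snd j))"
    by (rule Vitali_covering_lemma_cballs_balls[of X "\<lambda>v. 3 * snd v" "3 * R" fst, OF X3]) (assumption, rule that)
  \<comment> \<open>Empty balls are excluded: they lie in every triple and would spoil the
    uniqueness in \<open>N1\<close>.\<close>
  define N where "N = (\<lambda>k j. {v\<in>V. ball (x k j) (\<rho> k j) \<noteq> {} \<and> ball (x k j) (\<rho> k j) \<subseteq> cball (fst v) (3 * snd v)})"
  have N1: "(\<integral>\<^sup>+v. indicator (N k j) v \<partial>count_space V) \<le> 1" for k j
  proof (cases "N k j = {}")
    case False
    then obtain v0 where v0: "v0 \<in> N k j" by blast
    have "N k j = {v0}"
    proof -
      have "v = v0" if v: "v \<in> N k j" for v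
      proof (rule ccontr)
        assume "v \<noteq> v0"
        then have "disjnt (cball (fst v) (3 * snd v)) (cball (fst v0) (3 * snd v0))"
          using disj v v0 by (auto simp: pairwise_def N_def)
        then show False using v v0 unfolding N_def disjnt_def by blast
      qed
      then show ?thesis using v0 by blast
    qed
    moreover have "v0 \<in> V" using v0 by (simp add: N_def)
    ultimately show ?thesis by simp
  qed simp
  have le: "ennreal (snd v powr \<delta>) \<le>
      (\<integral>\<^sup>+k. indicator {m..} k * ennreal (2 powr (real_of_int (k - m) * p0)) * (\<Sum>j. ennreal (\<rho> k j powr \<delta>) * indicator (N k j) v) \<partial>count_space UNIV)"
    if v: "v \<in> V" for v
  proof -
    obtain z r where zr: "v = (z, r)" by (cases v)
    have "v \<in> X" using v V by blast
    then obtain k where k: "0 < r" "m \<le> k" "ennreal (2 powr (real_of_int (m - k) * p0) * r powr \<delta>) < touching_sum \<delta> (x k) (\<rho> k) z r"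
      by (auto simp: X_def zr)
    have "touching_sum \<delta> (x k) (\<rho> k) z r \<le> (\<Sum>j. ennreal (\<rho> k j powr \<delta>) * indicator (N k j) v)"
      unfolding touching_sum_def
    proof (intro suminf_le)
      fix j
      have "v \<in> N k j" if b: "ball (x k j) (\<rho> k j) \<inter> ball z r \<noteq> {}" "\<rho> k j \<le> r"
      proof -
        obtain w where w: "dist (x k j) w < \<rho> k j" "dist z w < r" using b(1) by auto
        have "ball (x k j) (\<rho> k j) \<subseteq> cball z (3 * r)"
        proof
          fix y assume "y \<in> ball (x k j) (\<rho> k j)"
          then have "dist (x k j) y < \<rho> k j" by simp
          then have "dist z y \<le> 3 * r"
            using w b(2) dist_triangle[of z y w] dist_triangle3[of w y "x k j"] by linarith
          then show "y \<in> cball z (3 * r)" by simp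
        qed
        moreover have "ball (x k j) (\<rho> k j) \<noteq> {}" using b(1) by blast
        ultimately show ?thesis using v by (simp add: N_def zr)
      qed
      then show "ennreal (\<rho> k j powr \<delta>) * indicator {j. ball (x k j) (\<rho> k j) \<inter> ball z r \<noteq> {} \<and> \<rho> k j \<le> r} j
         \<le> ennreal (\<rho> k j powr \<delta>) * indicator (N k j) v"
        by (auto split: split_indicator)
    qed auto
    with k(3) have less: "ennreal (2 powr (real_of_int (m - k) * p0) * r powr \<delta>) \<le> (\<Sum>j. ennreal (\<rho> k j powr \<delta>) * indicator (N k j) v)"
      by (meson less_imp_le order_trans)
    have "r powr \<delta> = 2 powr (real_of_int (k - m) * p0) * (2 powr (real_of_int (m - k) * p0) * r powr \<delta>)"
      by (simp add: mult.assoc[symmetric] powr_add[symmetric] left_diff_distrib)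
    then have "ennreal (snd v powr \<delta>) = ennreal (2 powr (real_of_int (k - m) * p0)) * ennreal (2 powr (real_of_int (m - k) * p0) * r powr \<delta>)"
      by (simp add: zr ennreal_mult[symmetric])
    also have "\<dots> \<le> ennreal (2 powr (real_of_int (k - m) * p0)) * (\<Sum>j. ennreal (\<rho> k j powr \<delta>) * indicator (N k j) v)"
      by (intro mult_left_mono less) auto
    also have "\<dots> = indicator {m..} k * ennreal (2 powr (real_of_int (k - m) * p0)) * (\<Sum>j. ennreal (\<rho> k j powr \<delta>) * indicator (N k j) v)"
      using k by simp
    also have "\<dots> \<le> (\<integral>\<^sup>+k. indicator {m..} k * ennreal (2 powr (real_of_int (k - m) * p0)) * (\<Sum>j. ennreal (\<rho> k j powr \<delta>) * indicator (N k j) v) \<partial>count_space UNIV)"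
      by (rule nn_integral_count_space_ge_point) simp
    finally show ?thesis .
  qed
  have "(\<integral>\<^sup>+v. ennreal (snd v powr \<delta>) \<partial>count_space V) \<le>
     (\<integral>\<^sup>+v. (\<integral>\<^sup>+k. indicator {m..} k * ennreal (2 powr (real_of_int (k - m) * p0)) * (\<Sum>j. ennreal (\<rho> k j powr \<delta>) * indicator (N k j) v) \<partial>count_space UNIV) \<partial>count_space V)"
    by (intro nn_integral_mono le) simp
  also have "\<dots> = (\<integral>\<^sup>+k. (\<integral>\<^sup>+v. indicator {m..} k * ennreal (2 powr (real_of_int (k - m) * p0)) * (\<Sum>j. ennreal (\<rho> k j powr \<delta>) * indicator (N k j) v) \<partial>count_space V) \<partial>count_space UNIV)"
    using V by (intro nn_integral_count_space_nn_integral[symmetric]) auto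
  also have "\<dots> = (\<integral>\<^sup>+k. indicator {m..} k * ennreal (2 powr (real_of_int (k - m) * p0)) * (\<Sum>j. ennreal (\<rho> k j powr \<delta>) * (\<integral>\<^sup>+v. indicator (N k j) v \<partial>count_space V)) \<partial>count_space UNIV)"
    by (simp add: nn_integral_cmult nn_integral_suminf)
  also have "\<dots> \<le> (\<integral>\<^sup>+k. indicator {m..} k * ennreal (2 powr (real_of_int (k - m) * p0)) * (\<Sum>j. ennreal (\<rho> k j powr \<delta>) * 1) \<partial>count_space UNIV)"
    by (intro nn_integral_mono mult_left_mono suminf_le N1) auto
  finally have sum: "(\<integral>\<^sup>+v. ennreal (snd v powr \<delta>) \<partial>count_space V) \<le>
      (\<integral>\<^sup>+k. indicator {m..} k * ennreal (2 powr (real_of_int (k - m) * p0)) * (\<Sum>j. ennreal (\<rho> k j powr \<delta>)) \<partial>count_space UNIV)"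
    by simp
  have "\<exists>(z', r')\<in>V. z \<in> ball z' (15 * r') \<and> r \<le> 15 * r'" if zr: "(z, r) \<in> X" for z r
  proof -
    obtain v where v: "v \<in> V" "cball z (3 * r) \<subseteq> ball (fst v) (15 * snd v)" using cov[OF zr] by auto
    have r: "0 < r" using zr by (simp add: X_def)
    then have "z \<in> cball z (3 * r)" by simp
    then have "z \<in> ball (fst v) (15 * snd v)" using v by blast
    moreover have "dist z (fst v) + 3 * r < 15 * snd v"
      using v(2) r unfolding cball_subset_ball_iff by auto
    then have "r \<le> 15 * snd v" using r zero_le_dist[of z "fst v"] by linarith
    ultimately show ?thesis using v(1) by (intro bexI[of _ v]) auto
  qed
  with V sum show ?thesis using that by blast
qed

section \<open>Assembling the family over all levels\<close>

lemma nn_integral_count_space_Un_le: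
  "(\<integral>\<^sup>+i. F i \<partial>count_space (A \<union> B)) \<le> (\<integral>\<^sup>+i. F i \<partial>count_space A) + (\<integral>\<^sup>+i. F i \<partial>count_space B)"
proof -
  have "(\<integral>\<^sup>+i. F i * indicator (A \<union> B) i \<partial>count_space UNIV)
    \<le> (\<integral>\<^sup>+i. F i * indicator A i \<partial>count_space UNIV) + (\<integral>\<^sup>+i. F i * indicator B i \<partial>count_space UNIV)"
    by (subst nn_integral_add[symmetric]) (auto intro!: nn_integral_mono split: split_indicator)
  then show ?thesis by (simp add: nn_integral_count_space_indicator)
qed

lemma nn_integral_count_space_Sigma:
  "(\<integral>\<^sup>+q. F (fst q) (snd q) \<partial>count_space (Sigma UNIV Q)) = (\<integral>\<^sup>+m. (\<integral>\<^sup>+q. F m q \<partial>count_space (Q m)) \<partial>count_space UNIV)"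
proof -
  have "(\<integral>\<^sup>+q. F (fst q) (snd q) * indicator (Sigma UNIV Q) q \<partial>count_space UNIV)
      = (\<integral>\<^sup>+m. (\<integral>\<^sup>+q. F m q * indicator (Q m) q \<partial>count_space UNIV) \<partial>count_space UNIV)"
    by (subst nn_integral_fst_count_space[symmetric]) (auto intro!: nn_integral_cong split: split_indicator)
  then show ?thesis by (simp add: nn_integral_count_space_indicator)
qed

text \<open>For fixed \<open>z\<close> and \<open>r\<close>, call \<open>m\<close> capturing if a
  ball of level \<open>m\<close> contains \<open>z\<close> and has radius at least \<open>r\<close>.
  A level that does not capture bounds the average over \<open>B(z, r)\<close> by a constant times
  \<open>2 powr m\<close>. So a nonzero integral forces capture at all low levels, summability
  forbids it at some level, and a capturing level whose successor does not capture has the right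
  height.\<close>

lemma obtain_maximal_ball_family:
  fixes \<delta> p :: real
  defines "n \<equiv> real DIM('a::euclidean_space)"
  assumes \<delta>: "0 < \<delta>" "\<delta> \<le> n" and p: "\<delta> / n < p"
  obtains C :: real where "0 < C"
    "\<And>(\<Omega>::'a set) f G R. (\<lambda>y. indicator \<Omega> y * f y) \<in> borel_measurable borel \<Longrightarrow>
      choquet_integral \<delta> \<Omega> (\<lambda>x. f x powr p) < ennreal G \<Longrightarrow>
      \<exists>I :: (real \<times> 'a \<times> real) set. countable I \<and> (\<forall>(h, y, \<rho>)\<in>I. 0 < h \<and> 0 \<le> \<rho>) \<and>
        (\<integral>\<^sup>+i. ennreal (fst i powr p * snd (snd i) powr \<delta>) \<partial>count_space I) \<le> ennreal (C * G) \<and>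
        (\<forall>z r. 0 < r \<longrightarrow> r \<le> R \<longrightarrow> (\<integral>\<^sup>+y\<in>\<Omega> \<inter> ball z r. ennreal (f y) \<partial>lborel) \<noteq> 0 \<longrightarrow>
          (\<exists>(h, y, \<rho>)\<in>I. z \<in> ball y \<rho> \<and> r \<le> \<rho> \<and>
             (\<integral>\<^sup>+y\<in>\<Omega> \<inter> ball z r. ennreal (f y) \<partial>lborel) \<le> ennreal (h * r powr n)))"
proof -
  have n: "0 < n" by (simp add: n_def)
  then have "0 < \<delta> / n" using \<delta> by simp
  then have p': "0 < p" using p by linarith
  obtain p0 where p0: "\<delta> / n < p0" "p0 < p" using p dense by blast
  then have p0': "0 < p0" using \<open>0 < \<delta> / n\<close> by linarith
  obtain C1 :: real where C1: "0 < C1"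
    "\<And>(\<Omega>::'a set) f G \<delta>. choquet_integral \<delta> \<Omega> (\<lambda>x. f x powr p) < ennreal G \<Longrightarrow>
      \<exists>(x :: int \<Rightarrow> nat \<Rightarrow> 'a) \<rho>. (\<forall>k j. 0 \<le> \<rho> k j) \<and>
        (\<forall>k. {x\<in>\<Omega>. f x > 2 powr real_of_int k} \<subseteq> (\<Union>j. ball (x k j) (\<rho> k j))) \<and>
        (\<integral>\<^sup>+k. ennreal (2 powr (real_of_int k * p)) * (\<Sum>j. ennreal (\<rho> k j powr \<delta>)) \<partial>count_space UNIV) \<le> ennreal (C1 * G)"
    using obtain_dyadic_covers[OF p'] by blast
  define \<mu> where "\<mu> = p - p0"
  have \<mu>: "0 < \<mu>" using p0 by (simp add: \<mu>_def)
  obtain Cg :: real where Cg: "0 < Cg"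
    "\<And>a::int. (\<integral>\<^sup>+k. ennreal (2 powr (- \<mu> * \<bar>real_of_int (k - a)\<bar>)) \<partial>count_space UNIV) \<le> ennreal Cg"
    using nn_integral_int_geometric[OF \<mu>] by blast
  define K where "K = unit_ball_vol n * (1 + 2 / (1 - 2 powr (1 - p0 * n / \<delta>)))"
  have "1 < p0 * n / \<delta>" using p0 \<delta> n by (simp add: field_simps)
  then have "2 powr (1 - p0 * n / \<delta>) < (1::real)"
    using powr_less_mono[of "1 - p0 * n / \<delta>" 0 "2::real"] by auto
  then have K: "0 < K" unfolding K_def n_def by (intro mult_pos_pos add_pos_pos unit_ball_vol_pos) auto
  \<comment> \<open>The factor 2 makes up for the step from the non-capturing level
    \<open>m + 1\<close> back to the capturing level \<open>m\<close>.\<close>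
  define A where "A = 2 * K"
  have A: "0 < A" using K by (simp add: A_def)
  \<comment> \<open>The dilations of the two kinds of balls in \<open>Q m\<close>: 15 for the Vitali
    balls, 2 for the covering balls.\<close>
  define D where "D = 15 powr \<delta> + 2 powr \<delta>"
  have D: "0 < D" by (simp add: D_def add_pos_pos)
  define C where "C = A powr p * D * Cg * C1"
  have C: "0 < C" using A D Cg(1) C1(1) by (simp add: C_def)
  show ?thesis
  proof (rule that[OF C])
    fix \<Omega> :: "'a set" and f G R
    assume fm: "(\<lambda>y. indicator \<Omega> y * f y) \<in> borel_measurable borel"
      and less: "choquet_integral \<delta> \<Omega> (\<lambda>x. f x powr p) < ennreal G"
    have G: "0 < G" using less by (metis ennreal_neg not_le not_less_zero)
    have "\<exists>(x :: int \<Rightarrow> nat \<Rightarrow> 'a) \<rho>. (\<forall>k j. 0 \<le> \<rho> k j) \<and>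
        (\<forall>k. {x\<in>\<Omega>. f x > 2 powr real_of_int k} \<subseteq> (\<Union>j. ball (x k j) (\<rho> k j))) \<and>
        (\<integral>\<^sup>+k. ennreal (2 powr (real_of_int k * p)) * (\<Sum>j. ennreal (\<rho> k j powr \<delta>)) \<partial>count_space UNIV) \<le> ennreal (C1 * G)"
      by (rule C1(2)[OF less])
    then obtain x :: "int \<Rightarrow> nat \<Rightarrow> 'a" and \<rho> where \<rho>0: "\<forall>k j. 0 \<le> \<rho> k j"
      and cov0: "\<forall>k. {x\<in>\<Omega>. f x > 2 powr real_of_int k} \<subseteq> (\<Union>j. ball (x k j) (\<rho> k j))"
      and sumS: "(\<integral>\<^sup>+k. ennreal (2 powr (real_of_int k * p)) * (\<Sum>j. ennreal (\<rho> k j powr \<delta>)) \<partial>count_space UNIV) \<le> ennreal (C1 * G)"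
      by (elim exE conjE) (rule that)
    note \<rho> = \<rho>0[rule_format] and cov = cov0[rule_format]
    define S where "S = (\<lambda>k. (\<Sum>j. ennreal (\<rho> k j powr \<delta>)))"
    define X where "X = (\<lambda>m. {(z, r). 0 < r \<and> r \<le> R \<and> (\<exists>k\<ge>m. ennreal (2 powr (real_of_int (m - k) * p0) * r powr \<delta>) < touching_sum \<delta> (x k) (\<rho> k) z r)})"
    define Z where "Z = (\<lambda>m. (\<integral>\<^sup>+k. indicator {m..} k * ennreal (2 powr (real_of_int (k - m) * p0)) * S k \<partial>count_space UNIV))"
    have "\<forall>m. \<exists>V. countable V \<and> V \<subseteq> X m \<and>
      (\<forall>z r. (z, r) \<in> X m \<longrightarrow> (\<exists>(z', r')\<in>V. z \<in> ball z' (15 * r') \<and> r \<le> 15 * r')) \<and>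
      (\<integral>\<^sup>+v. ennreal (snd v powr \<delta>) \<partial>count_space V) \<le> Z m"
    proof
      fix m
      show "\<exists>V. countable V \<and> V \<subseteq> X m \<and>
        (\<forall>z r. (z, r) \<in> X m \<longrightarrow> (\<exists>(z', r')\<in>V. z \<in> ball z' (15 * r') \<and> r \<le> 15 * r')) \<and>
        (\<integral>\<^sup>+v. ennreal (snd v powr \<delta>) \<partial>count_space V) \<le> Z m"
        unfolding X_def Z_def S_def
        by (rule obtain_vitali_selection[where x = x and \<rho> = \<rho> and R = R and m = m and ?p0.0 = p0 and \<delta> = \<delta>]) (intro exI conjI allI impI; assumption?; blast)
    qed
    from choice[OF this] obtain V where V: "\<forall>m. countable (V m) \<and> V m \<subseteq> X m \<and>
      (\<forall>z r. (z, r) \<in> X m \<longrightarrow> (\<exists>(z', r')\<in>V m. z \<in> ball z' (15 * r') \<and> r \<le> 15 * r')) \<and>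
      (\<integral>\<^sup>+v. ennreal (snd v powr \<delta>) \<partial>count_space (V m)) \<le> Z m"
      by (elim exE) (rule that)
    \<comment> \<open>The doubled covering balls take care of large ones: a covering ball that meets
      \<open>B(z, r)\<close> and has radius above \<open>r\<close> contains \<open>z\<close> in its
      double.\<close>
    define Q where "Q = (\<lambda>m::int. (\<lambda>v. (fst v, 15 * snd v)) ` V m \<union> (\<lambda>kj. (x (fst kj) (snd kj), 2 * \<rho> (fst kj) (snd kj))) ` (Sigma UNIV (\<lambda>k. if m \<le> k then UNIV else {})))"
    define I where "I = (\<lambda>mq. (A * 2 powr real_of_int (fst mq), snd mq)) ` (Sigma UNIV Q)"
    have Qnn: "0 \<le> snd q" if "q \<in> Q m" for q m
    proof -
      have "0 \<le> snd v" if "v \<in> V m" for v using V that by (force simp: X_def)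
      then show ?thesis using that \<rho> by (auto simp: Q_def)
    qed
    have cI: "countable I"
      unfolding I_def Q_def using V by (intro countable_image countable_SIGMA countable_Un) auto
    have posI: "\<forall>(h, y, \<rho>)\<in>I. 0 < h \<and> 0 \<le> \<rho>"
      using A Qnn unfolding I_def by fastforce
    have sumQ: "(\<integral>\<^sup>+q. ennreal (snd q powr \<delta>) \<partial>count_space (Q m)) \<le> ennreal D * Z m" for m
    proof -
      have "(\<integral>\<^sup>+q. ennreal (snd q powr \<delta>) \<partial>count_space (Q m)) \<le>
         (\<integral>\<^sup>+v. ennreal (snd (fst v, 15 * snd v) powr \<delta>) \<partial>count_space (V m)) +
         (\<integral>\<^sup>+kj. ennreal (snd (x (fst kj) (snd kj), 2 * \<rho> (fst kj) (snd kj)) powr \<delta>) \<partial>count_space (Sigma UNIV (\<lambda>k. if m \<le> k then UNIV else {})))"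
        unfolding Q_def
        by (intro order_trans[OF nn_integral_count_space_Un_le] add_mono nn_integral_count_space_image_le)
      also have "(\<integral>\<^sup>+v. ennreal (snd (fst v, 15 * snd v) powr \<delta>) \<partial>count_space (V m)) \<le> ennreal (15 powr \<delta>) * Z m"
      proof -
        have "0 \<le> snd v" if "v \<in> V m" for v using V that by (force simp: X_def)
        then have "(\<integral>\<^sup>+v. ennreal (snd (fst v, 15 * snd v) powr \<delta>) \<partial>count_space (V m))
           = (\<integral>\<^sup>+v. ennreal (15 powr \<delta>) * ennreal (snd v powr \<delta>) \<partial>count_space (V m))"
          by (intro nn_integral_cong) (auto simp: powr_mult ennreal_mult)
        also have "\<dots> = ennreal (15 powr \<delta>) * (\<integral>\<^sup>+v. ennreal (snd v powr \<delta>) \<partial>count_space (V m))"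
          by (rule nn_integral_cmult) auto
        also have "\<dots> \<le> ennreal (15 powr \<delta>) * Z m" using V by (intro mult_left_mono) auto
        finally show ?thesis .
      qed
      also have "(\<integral>\<^sup>+kj. ennreal (snd (x (fst kj) (snd kj), 2 * \<rho> (fst kj) (snd kj)) powr \<delta>) \<partial>count_space (Sigma UNIV (\<lambda>k. if m \<le> k then UNIV else {})))
         \<le> ennreal (2 powr \<delta>) * Z m"
      proof -
        have "(\<integral>\<^sup>+kj. ennreal (snd (x (fst kj) (snd kj), 2 * \<rho> (fst kj) (snd kj)) powr \<delta>) \<partial>count_space (Sigma UNIV (\<lambda>k. if m \<le> k then UNIV else {})))
          = (\<integral>\<^sup>+k. (\<integral>\<^sup>+j. ennreal ((2 * \<rho> k j) powr \<delta>) \<partial>count_space (if m \<le> k then UNIV else {})) \<partial>count_space UNIV)"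
          using nn_integral_count_space_Sigma[where F = "\<lambda>k j. ennreal ((2 * \<rho> k j) powr \<delta>)" and Q = "\<lambda>k. if m \<le> k then UNIV else {}"] by simp
        also have "\<dots> \<le> (\<integral>\<^sup>+k. ennreal (2 powr \<delta>) * (indicator {m..} k * ennreal (2 powr (real_of_int (k - m) * p0)) * S k) \<partial>count_space UNIV)"
        proof (intro nn_integral_mono)
          fix k
          show "(\<integral>\<^sup>+j. ennreal ((2 * \<rho> k j) powr \<delta>) \<partial>count_space (if m \<le> k then UNIV else {}))
            \<le> ennreal (2 powr \<delta>) * (indicator {m..} k * ennreal (2 powr (real_of_int (k - m) * p0)) * S k)"
          proof (cases "m \<le> k")
            case True
            have "(\<integral>\<^sup>+j. ennreal ((2 * \<rho> k j) powr \<delta>) \<partial>count_space UNIV) = (\<Sum>j. ennreal (2 powr \<delta>) * ennreal (\<rho> k j powr \<delta>))"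
              using \<rho> by (simp add: nn_integral_count_space_nat powr_mult ennreal_mult)
            also have "\<dots> = ennreal (2 powr \<delta>) * (1 * S k)" by (simp add: S_def)
            \<comment> \<open>For \<open>m \<le> k\<close> the weight is at least 1, so
              \<open>Z m\<close> dominates the doubled balls as well as the Vitali balls.\<close>
            also have "\<dots> \<le> ennreal (2 powr \<delta>) * (ennreal (2 powr (real_of_int (k - m) * p0)) * S k)"
              using True p0' ge_one_powr_ge_zero[of 2 "real_of_int (k - m) * p0"]
              by (intro mult_left_mono mult_right_mono) auto
            finally show ?thesis using True by simp
          qed (simp add: nn_integral_count_space_finite)
        qed
        also have "\<dots> = ennreal (2 powr \<delta>) * Z m" unfolding Z_def by (rule nn_integral_cmult) auto
        finally show ?thesis .
      qed
      finally have "(\<integral>\<^sup>+q. ennreal (snd q powr \<delta>) \<partial>count_space (Q m)) \<le> ennreal (15 powr \<delta>) * Z m + ennreal (2 powr \<delta>) * Z m"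
        by (simp add: add_mono)
      then show ?thesis by (simp add: D_def distrib_right)
    qed
    have sumZ: "(\<integral>\<^sup>+m. ennreal (2 powr (real_of_int m * p)) * Z m \<partial>count_space UNIV) \<le> ennreal Cg * ennreal (C1 * G)"
    proof -
      have "(\<integral>\<^sup>+m. ennreal (2 powr (real_of_int m * p)) * Z m \<partial>count_space UNIV)
        = (\<integral>\<^sup>+m. (\<integral>\<^sup>+k. ennreal (2 powr (real_of_int m * p)) * (indicator {m..} k * ennreal (2 powr (real_of_int (k - m) * p0)) * S k) \<partial>count_space UNIV) \<partial>count_space UNIV)"
        unfolding Z_def by (intro nn_integral_cong nn_integral_cmult[symmetric]) auto
      also have "\<dots> = (\<integral>\<^sup>+k. (\<integral>\<^sup>+m. ennreal (2 powr (real_of_int m * p)) * (indicator {m..} k * ennreal (2 powr (real_of_int (k - m) * p0)) * S k) \<partial>count_space UNIV) \<partial>count_space UNIV)"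
        by (rule nn_integral_count_space_nn_integral) auto
      also have "\<dots> \<le> (\<integral>\<^sup>+k. (\<integral>\<^sup>+m. ennreal (2 powr (real_of_int k * p)) * S k * ennreal (2 powr (- \<mu> * \<bar>real_of_int (m - k)\<bar>)) \<partial>count_space UNIV) \<partial>count_space UNIV)"
      proof (intro nn_integral_mono)
        fix k m :: int
        show "ennreal (2 powr (real_of_int m * p)) * (indicator {m..} k * ennreal (2 powr (real_of_int (k - m) * p0)) * S k)
          \<le> ennreal (2 powr (real_of_int k * p)) * S k * ennreal (2 powr (- \<mu> * \<bar>real_of_int (m - k)\<bar>))"
        proof (cases "m \<le> k")
          case True
          \<comment> \<open>After the exchange of sums, the levels \<open>m \<le> k\<close>
            contribute a geometric series with exponent \<open>\<mu> = p - p0\<close>, whose sum is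
            bounded independently of \<open>k\<close>.\<close>
          have "2 powr (real_of_int m * p) * 2 powr (real_of_int (k - m) * p0) = 2 powr (real_of_int k * p) * 2 powr (- \<mu> * \<bar>real_of_int (m - k)\<bar>)"
            using True by (simp add: powr_add[symmetric] \<mu>_def algebra_simps)
          then have "ennreal (2 powr (real_of_int m * p)) * ennreal (2 powr (real_of_int (k - m) * p0)) = ennreal (2 powr (real_of_int k * p)) * ennreal (2 powr (- \<mu> * \<bar>real_of_int (m - k)\<bar>))"
            by (simp only: ennreal_mult[symmetric] powr_ge_zero)
          then have "ennreal (2 powr (real_of_int m * p)) * ennreal (2 powr (real_of_int (k - m) * p0)) * S k = ennreal (2 powr (real_of_int k * p)) * ennreal (2 powr (- \<mu> * \<bar>real_of_int (m - k)\<bar>)) * S k"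
            by simp
          then show ?thesis using True by (simp add: mult_ac)
        qed simp
      qed
      also have "\<dots> = (\<integral>\<^sup>+k. ennreal (2 powr (real_of_int k * p)) * S k * (\<integral>\<^sup>+m. ennreal (2 powr (- \<mu> * \<bar>real_of_int (m - k)\<bar>)) \<partial>count_space UNIV) \<partial>count_space UNIV)"
        by (intro nn_integral_cong nn_integral_cmult) auto
      also have "\<dots> \<le> (\<integral>\<^sup>+k. ennreal Cg * (ennreal (2 powr (real_of_int k * p)) * S k) \<partial>count_space UNIV)"
        using Cg(2) by (intro nn_integral_mono) (simp add: mult.commute[of "ennreal Cg"] mult_left_mono)
      also have "\<dots> = ennreal Cg * (\<integral>\<^sup>+k. ennreal (2 powr (real_of_int k * p)) * S k \<partial>count_space UNIV)"
        by (rule nn_integral_cmult) auto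
      also have "\<dots> \<le> ennreal Cg * ennreal (C1 * G)"
        using sumS by (intro mult_left_mono) (auto simp: S_def)
      finally show ?thesis .
    qed
    have sumI: "(\<integral>\<^sup>+i. ennreal (fst i powr p * snd (snd i) powr \<delta>) \<partial>count_space I) \<le> ennreal (C * G)"
    proof -
      have "(\<integral>\<^sup>+i. ennreal (fst i powr p * snd (snd i) powr \<delta>) \<partial>count_space I) \<le>
        (\<integral>\<^sup>+mq. ennreal ((A * 2 powr real_of_int (fst mq)) powr p * snd (snd mq) powr \<delta>) \<partial>count_space (Sigma UNIV Q))"
        unfolding I_def by (rule order_trans[OF nn_integral_count_space_image_le]) simp
      also have "\<dots> = (\<integral>\<^sup>+m. (\<integral>\<^sup>+q. ennreal ((A * 2 powr real_of_int m) powr p * snd q powr \<delta>) \<partial>count_space (Q m)) \<partial>count_space UNIV)"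
        by (rule nn_integral_count_space_Sigma[where F = "\<lambda>m q. ennreal ((A * 2 powr real_of_int m) powr p * snd q powr \<delta>)"])
      also have "\<dots> = (\<integral>\<^sup>+m. ennreal (A powr p) * ennreal (2 powr (real_of_int m * p)) * (\<integral>\<^sup>+q. ennreal (snd q powr \<delta>) \<partial>count_space (Q m)) \<partial>count_space UNIV)"
      proof (intro nn_integral_cong)
        fix m :: int
        have "(\<integral>\<^sup>+q. ennreal ((A * 2 powr real_of_int m) powr p * snd q powr \<delta>) \<partial>count_space (Q m))
          = (\<integral>\<^sup>+q. ennreal (A powr p) * ennreal (2 powr (real_of_int m * p)) * ennreal (snd q powr \<delta>) \<partial>count_space (Q m))"
          using A by (intro nn_integral_cong) (simp add: powr_mult powr_powr ennreal_mult)
        also have "\<dots> = ennreal (A powr p) * ennreal (2 powr (real_of_int m * p)) * (\<integral>\<^sup>+q. ennreal (snd q powr \<delta>) \<partial>count_space (Q m))"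
          by (rule nn_integral_cmult) simp
        finally show "(\<integral>\<^sup>+q. ennreal ((A * 2 powr real_of_int m) powr p * snd q powr \<delta>) \<partial>count_space (Q m))
          = ennreal (A powr p) * ennreal (2 powr (real_of_int m * p)) * (\<integral>\<^sup>+q. ennreal (snd q powr \<delta>) \<partial>count_space (Q m))" .
      qed
      also have "\<dots> \<le> (\<integral>\<^sup>+m. ennreal (A powr p) * ennreal (2 powr (real_of_int m * p)) * (ennreal D * Z m) \<partial>count_space UNIV)"
        by (intro nn_integral_mono mult_left_mono sumQ) auto
      also have "\<dots> = (\<integral>\<^sup>+m. ennreal (A powr p * D) * (ennreal (2 powr (real_of_int m * p)) * Z m) \<partial>count_space UNIV)"
        using D by (intro nn_integral_cong) (simp add: ennreal_mult mult_ac)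
      also have "\<dots> = ennreal (A powr p * D) * (\<integral>\<^sup>+m. ennreal (2 powr (real_of_int m * p)) * Z m \<partial>count_space UNIV)"
        by (rule nn_integral_cmult) auto
      also have "\<dots> \<le> ennreal (A powr p * D) * (ennreal Cg * ennreal (C1 * G))"
        by (intro mult_left_mono sumZ) auto
      also have "\<dots> = ennreal (C * G)"
        using D Cg(1) C1(1) G by (simp add: C_def ennreal_mult[symmetric] mult_ac)
      finally show ?thesis .
    qed
    have capt: "\<exists>(h, y, \<rho>)\<in>I. z \<in> ball y \<rho> \<and> r \<le> \<rho> \<and>
             (\<integral>\<^sup>+y\<in>\<Omega> \<inter> ball z r. ennreal (f y) \<partial>lborel) \<le> ennreal (h * r powr n)"
      if r: "0 < r" "r \<le> R" and J0: "(\<integral>\<^sup>+y\<in>\<Omega> \<inter> ball z r. ennreal (f y) \<partial>lborel) \<noteq> 0" for z r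
    proof -
      define J where "J = (\<integral>\<^sup>+y\<in>\<Omega> \<inter> ball z r. ennreal (f y) \<partial>lborel)"
      define P where "P = (\<lambda>m. \<exists>q\<in>Q m. z \<in> ball (fst q) (snd q) \<and> r \<le> snd q)"
      have notP: "J \<le> ennreal (K * 2 powr m * r powr n)" if nP: "\<not> P m" for m
        unfolding J_def K_def n_def
      proof (rule nn_integral_ball_le_of_sparse_covers[OF \<delta>(1)])
        show "\<rho> k j \<le> r" if kj: "m \<le> k" "ball (x k j) (\<rho> k j) \<inter> ball z r \<noteq> {}" for k j
        proof (rule ccontr)
          assume "\<not> \<rho> k j \<le> r"
          then have gt: "r < \<rho> k j" by simp
          obtain w where "dist (x k j) w < \<rho> k j" "dist z w < r" using kj(2) by auto
          then have "dist (x k j) z < 2 * \<rho> k j" using gt dist_triangle2[of "x k j" z w] by linarith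
          moreover have "(x k j, 2 * \<rho> k j) \<in> Q m"
            unfolding Q_def using kj(1) by (intro UnI2 image_eqI[of _ _ "(k, j)"]) auto
          ultimately have "P m" unfolding P_def using gt r by (intro bexI[of _ "(x k j, 2 * \<rho> k j)"]) auto
          with nP show False by simp
        qed
        show "touching_sum \<delta> (x k) (\<rho> k) z r \<le> ennreal (2 powr (real_of_int (m - k) * p0) * r powr \<delta>)" if k: "m \<le> k" for k
        proof (rule ccontr)
          assume "\<not> ?thesis"
          then have "(z, r) \<in> X m" using r k by (auto simp: X_def not_le)
          then obtain v where v: "v \<in> V m" "z \<in> ball (fst v) (15 * snd v)" "r \<le> 15 * snd v"
            using V by fastforce
          then have "(fst v, 15 * snd v) \<in> Q m" by (auto simp: Q_def)
          then have "P m" unfolding P_def using v by (intro bexI[of _ "(fst v, 15 * snd v)"]) auto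
          with nP show False by simp
        qed
      qed (use \<delta> p0 fm \<rho> cov r in \<open>auto simp: n_def\<close>)
      have hP: "\<exists>(h, y, \<rho>)\<in>I. z \<in> ball y \<rho> \<and> r \<le> \<rho> \<and> h = A * 2 powr real_of_int m" if Pm: "P m" for m
      proof -
        obtain q where q: "q \<in> Q m" "z \<in> ball (fst q) (snd q)" "r \<le> snd q" using Pm by (auto simp: P_def)
        have "(A * 2 powr real_of_int m, q) \<in> I" unfolding I_def using q(1) by (intro image_eqI[of _ _ "(m, q)"]) auto
        then show ?thesis using q by (intro bexI[of _ "(A * 2 powr real_of_int m, q)"]) (auto simp: split_beta)
      qed
      \<comment> \<open>Otherwise for every \<open>m\<close> the family has a ball of height
        \<open>A * 2 powr m\<close> and radius at least \<open>r\<close>, and its single term would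
        exceed the bound \<open>C * G\<close> for large \<open>m\<close>.\<close>
      have "\<exists>m. \<not> P m"
      proof (rule ccontr)
        assume "\<not> (\<exists>m. \<not> P m)"
        then have all: "P m" for m by blast
        have bnd: "(A * 2 powr real_of_int m) powr p * r powr \<delta> \<le> C * G" for m
        proof -
          obtain i where i: "i \<in> I" "r \<le> snd (snd i)" "fst i = A * 2 powr real_of_int m"
            using hP[OF all[of m]] by force
          have "ennreal (fst i powr p * snd (snd i) powr \<delta>) \<le> ennreal (C * G)"
            using nn_integral_count_space_ge_point[OF i(1), of "\<lambda>i. ennreal (fst i powr p * snd (snd i) powr \<delta>)"] sumI
            by (rule order_trans)
          then have "fst i powr p * snd (snd i) powr \<delta> \<le> C * G"
            using C G by (subst (asm) ennreal_le_iff) auto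
          moreover have "fst i powr p * r powr \<delta> \<le> fst i powr p * snd (snd i) powr \<delta>"
            using i(2) r \<delta> by (intro mult_left_mono powr_mono2) auto
          ultimately show ?thesis using i(3) by simp
        qed
        define B where "B = C * G / (A powr p * r powr \<delta>)"
        obtain N :: nat where N: "B < (2 powr p) ^ N"
          using real_arch_pow[of "2 powr p" B] p' powr_less_mono[of 0 p "2::real"] by auto
        have "(A * 2 powr real_of_int (int N)) powr p * r powr \<delta> = (A powr p * r powr \<delta>) * (2 powr p) ^ N"
          using A by (simp add: powr_mult powr_powr powr_realpow[symmetric] mult_ac)
        also have "\<dots> > (A powr p * r powr \<delta>) * B"
          using N A r by (intro mult_strict_left_mono) auto
        also have "(A powr p * r powr \<delta>) * B = C * G" using A r by (simp add: B_def)
        finally show False using bnd[of "int N"] by linarith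
      qed
      then obtain m0 where m0: "\<not> P m0" by blast
      have "J \<le> ennreal (K * 2 powr m0 * r powr n)" by (rule notP[OF m0])
      then have "J < \<infinity>" by (rule le_less_trans) simp
      then obtain j where j: "J = ennreal j" "0 < j" using J0 unfolding J_def[symmetric]
        by (cases J) (auto simp: less_le)
      have lowP: "P m" if "K * 2 powr real_of_int m * r powr n < j" for m
      proof (rule ccontr)
        assume "\<not> P m"
        from notP[OF this] j that K show False by (simp add: ennreal_le_iff)
      qed
      \<comment> \<open>The selections \<open>V m\<close> are made independently, so monotonicity of
        \<open>P\<close> is not at hand. Instead one climbs by induction from a low level, where
        \<open>lowP\<close> gives \<open>P\<close>, up to \<open>m0\<close>, where it fails.\<close>
      have "\<exists>m. P m \<and> \<not> P (m + 1)"
      proof (rule ccontr)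
        assume "\<not> ?thesis"
        then have step: "P m \<Longrightarrow> P (m + 1)" for m by blast
        obtain N :: nat where N: "(1/2) ^ N < j / (K * 2 powr m0 * r powr n)"
          using real_arch_pow_inv[of "j / (K * 2 powr m0 * r powr n)" "1/2"] j K r by auto
        have "K * 2 powr real_of_int (m0 - int N) * r powr n = (1/2) ^ N * (K * 2 powr m0 * r powr n)"
          by (simp add: powr_diff powr_realpow power_divide)
        also have "\<dots> < j" using N K r by (simp add: pos_less_divide_eq)
        finally have "P (m0 - int N)" by (rule lowP)
        then have "P (m0 - int N + int i)" for i
          by (induction i) (use step in \<open>auto simp: add.assoc[symmetric] add.commute[of 1]\<close>)
        from this[of N] m0 show False by simp
      qed
      then obtain m where m: "P m" "\<not> P (m + 1)" by blast
      have "J \<le> ennreal (A * 2 powr real_of_int m * r powr n)"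
        using notP[OF m(2)] by (simp add: A_def powr_add mult_ac)
      then show ?thesis using hP[OF m(1)] unfolding J_def by fastforce
    qed
    show "\<exists>I :: (real \<times> 'a \<times> real) set. countable I \<and> (\<forall>(h, y, \<rho>)\<in>I. 0 < h \<and> 0 \<le> \<rho>) \<and>
        (\<integral>\<^sup>+i. ennreal (fst i powr p * snd (snd i) powr \<delta>) \<partial>count_space I) \<le> ennreal (C * G) \<and>
        (\<forall>z r. 0 < r \<longrightarrow> r \<le> R \<longrightarrow> (\<integral>\<^sup>+y\<in>\<Omega> \<inter> ball z r. ennreal (f y) \<partial>lborel) \<noteq> 0 \<longrightarrow>
          (\<exists>(h, y, \<rho>)\<in>I. z \<in> ball y \<rho> \<and> r \<le> \<rho> \<and>
             (\<integral>\<^sup>+y\<in>\<Omega> \<inter> ball z r. ennreal (f y) \<partial>lborel) \<le> ennreal (h * r powr n)))"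
      by (intro exI[of _ I] conjI allI impI cI posI sumI capt)
  qed
qed

subsection \<open>The Poincare--Sobolev inequality\<close>

text \<open>The two powers agree at the radius \<open>L\<close>, with common value \<open>V\<close>,
  the stated product. Away from \<open>L\<close> the minimum decays geometrically in both directions
  with exponent at least \<open>min \<alpha> \<gamma>\<close>, so the sum is a multiple of
  \<open>V\<close>, wherever the dyadic sequence starts.\<close>

lemma suminf_min_powr_le:
  fixes \<alpha> \<gamma> :: real
  assumes \<alpha>: "0 < \<alpha>" and \<gamma>: "0 < \<gamma>"
  obtains C :: real where "0 < C"
    "\<And>R N K. 0 < R \<Longrightarrow> 0 < N \<Longrightarrow> 0 < K \<Longrightarrow>
      (\<Sum>j. ennreal (min (N * (R / 2 ^ j) powr \<alpha>) (K * (R / 2 ^ j) powr - \<gamma>)))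
      \<le> ennreal (C * (N powr (\<gamma> / (\<alpha> + \<gamma>)) * K powr (\<alpha> / (\<alpha> + \<gamma>))))"
proof -
  define \<mu> where "\<mu> = min \<alpha> \<gamma>"
  have \<mu>: "0 < \<mu>" "\<mu> \<le> \<alpha>" "\<mu> \<le> \<gamma>" using assms by (auto simp: \<mu>_def)
  obtain Cg :: real where Cg: "0 < Cg"
    "\<And>a::int. (\<integral>\<^sup>+k. ennreal (2 powr (- \<mu> * \<bar>real_of_int (k - a)\<bar>)) \<partial>count_space UNIV) \<le> ennreal Cg"
    using nn_integral_int_geometric[OF \<mu>(1)] by blast
  show ?thesis
  proof (rule that[of "2 powr \<mu> * Cg"])
    show "0 < 2 powr \<mu> * Cg" using Cg by simp
    fix R N K :: real assume pos: "0 < R" "0 < N" "0 < K"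
    \<comment> \<open>The solution of
      \<open>N * L powr \<alpha> = K * L powr - \<gamma>\<close>.\<close>
    define L where "L = (K / N) powr (1 / (\<alpha> + \<gamma>))"
    have L: "0 < L" using pos by (simp add: L_def)
    define V where "V = N powr (\<gamma> / (\<alpha> + \<gamma>)) * K powr (\<alpha> / (\<alpha> + \<gamma>))"
    have V: "0 < V" using pos by (simp add: V_def)
    have s: "\<gamma> / (\<alpha> + \<gamma>) = 1 - \<alpha> / (\<alpha> + \<gamma>)" "\<alpha> / (\<alpha> + \<gamma>) = 1 - \<gamma> / (\<alpha> + \<gamma>)" using assms by (auto simp: field_simps)
    have NL: "N * L powr \<alpha> = V"
      unfolding V_def L_def s(1) using pos by (simp add: powr_powr powr_divide powr_diff field_simps)
    have KL: "K * L powr - \<gamma> = V"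
      unfolding V_def L_def s(2) using pos by (simp add: powr_powr powr_divide powr_diff powr_minus field_simps)
    define y where "y = log 2 (R / L)"
    have y: "R / L = 2 powr y" using pos L by (simp add: y_def)
    have est: "min (N * (R / 2 ^ j) powr \<alpha>) (K * (R / 2 ^ j) powr - \<gamma>)
        \<le> V * 2 powr \<mu> * 2 powr (- \<mu> * \<bar>real_of_int (int j - \<lfloor>y\<rfloor>)\<bar>)" for j
    proof -
      have r: "R / 2 ^ j = L * 2 powr (y - real j)"
        using y L by (simp add: powr_diff powr_realpow field_simps)
      have 1: "N * (R / 2 ^ j) powr \<alpha> = V * 2 powr (\<alpha> * (y - real j))"
        unfolding r using L NL[symmetric] by (simp add: powr_mult powr_powr mult.commute)
      have 2: "K * (R / 2 ^ j) powr - \<gamma> = V * 2 powr (- \<gamma> * (y - real j))"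
        unfolding r using L KL[symmetric] by (simp add: powr_mult powr_powr mult.commute)
      have "min (N * (R / 2 ^ j) powr \<alpha>) (K * (R / 2 ^ j) powr - \<gamma>) \<le> V * 2 powr (- \<mu> * \<bar>y - real j\<bar>)"
      proof (cases "y \<le> real j")
        case True
        have "\<alpha> * (y - real j) \<le> \<mu> * (y - real j)" using \<mu> True by (intro mult_right_mono_neg) auto
        then have "V * 2 powr (\<alpha> * (y - real j)) \<le> V * 2 powr (- \<mu> * \<bar>y - real j\<bar>)"
          using V True by (intro mult_left_mono powr_mono) (auto simp: algebra_simps)
        then show ?thesis unfolding 1 by simp
      next
        case False
        have "\<mu> * (y - real j) \<le> \<gamma> * (y - real j)" using \<mu> False by (intro mult_right_mono) auto
        then have "V * 2 powr (- \<gamma> * (y - real j)) \<le> V * 2 powr (- \<mu> * \<bar>y - real j\<bar>)"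
          using V False by (intro mult_left_mono powr_mono) (auto simp: algebra_simps)
        then show ?thesis unfolding 2 by simp
      qed
      \<comment> \<open>Replacing \<open>y\<close> by its floor, to reach a sum over integers,
        changes the distance by at most 1 and costs the factor \<open>2 powr \<mu>\<close>.\<close>
      also have "\<dots> \<le> V * 2 powr (\<mu> + - \<mu> * \<bar>real_of_int (int j - \<lfloor>y\<rfloor>)\<bar>)"
      proof -
        have "\<bar>real_of_int (int j - \<lfloor>y\<rfloor>)\<bar> \<le> \<bar>y - real j\<bar> + 1"
          using of_int_floor_le[of y] real_of_int_floor_add_one_gt[of y] by simp linarith
        then have "\<mu> * \<bar>real_of_int (int j - \<lfloor>y\<rfloor>)\<bar> \<le> \<mu> * (\<bar>y - real j\<bar> + 1)"
          using \<mu> by (intro mult_left_mono) auto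
        then show ?thesis using V by (intro mult_left_mono powr_mono) (auto simp: algebra_simps)
      qed
      also have "\<dots> = V * 2 powr \<mu> * 2 powr (- \<mu> * \<bar>real_of_int (int j - \<lfloor>y\<rfloor>)\<bar>)"
        by (simp add: powr_add[of 2 \<mu>] powr_minus powr_diff field_simps)
      finally show ?thesis .
    qed
    have "(\<Sum>j. ennreal (min (N * (R / 2 ^ j) powr \<alpha>) (K * (R / 2 ^ j) powr - \<gamma>)))
      \<le> (\<Sum>j. ennreal (V * 2 powr \<mu>) * ennreal (2 powr (- \<mu> * \<bar>real_of_int (int j - \<lfloor>y\<rfloor>)\<bar>)))"
    proof (intro suminf_le)
      fix j
      show "ennreal (min (N * (R / 2 ^ j) powr \<alpha>) (K * (R / 2 ^ j) powr - \<gamma>))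
        \<le> ennreal (V * 2 powr \<mu>) * ennreal (2 powr (- \<mu> * \<bar>real_of_int (int j - \<lfloor>y\<rfloor>)\<bar>))"
        using V by (subst ennreal_mult[symmetric]) (auto simp del: of_int_diff intro!: ennreal_leI order_trans[OF est[of j]])
    qed auto
    also have "\<dots> = ennreal (V * 2 powr \<mu>) * (\<integral>\<^sup>+j. ennreal (2 powr (- \<mu> * \<bar>real_of_int (int j - \<lfloor>y\<rfloor>)\<bar>)) \<partial>count_space UNIV)"
      by (simp only: nn_integral_count_space_nat ennreal_suminf_cmult)
    also have "(\<integral>\<^sup>+j. ennreal (2 powr (- \<mu> * \<bar>real_of_int (int j - \<lfloor>y\<rfloor>)\<bar>)) \<partial>count_space UNIV)
      = (\<integral>\<^sup>+k. ennreal (2 powr (- \<mu> * \<bar>real_of_int (k - \<lfloor>y\<rfloor>)\<bar>)) \<partial>count_space (range int))"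
      by (rule nn_integral_bij_count_space) (simp add: bij_betw_def)
    also have "\<dots> \<le> (\<integral>\<^sup>+k. ennreal (2 powr (- \<mu> * \<bar>real_of_int (k - \<lfloor>y\<rfloor>)\<bar>)) \<partial>count_space UNIV)"
      by (subst nn_integral_count_space_indicator) (auto intro!: nn_integral_mono split: split_indicator)
    also have "\<dots> \<le> ennreal Cg" by (rule Cg(2))
    finally have "(\<Sum>j. ennreal (min (N * (R / 2 ^ j) powr \<alpha>) (K * (R / 2 ^ j) powr - \<gamma>)))
      \<le> ennreal (V * 2 powr \<mu>) * ennreal Cg" by (simp add: mult_left_mono)
    also have "\<dots> = ennreal (2 powr \<mu> * Cg * V)" using V Cg(1) by (simp add: ennreal_mult[symmetric] mult_ac)
    finally show "(\<Sum>j. ennreal (min (N * (R / 2 ^ j) powr \<alpha>) (K * (R / 2 ^ j) powr - \<gamma>)))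
      \<le> ennreal (2 powr \<mu> * Cg * (N powr (\<gamma> / (\<alpha> + \<gamma>)) * K powr (\<alpha> / (\<alpha> + \<gamma>))))" by (simp add: V_def)
  qed
qed

text \<open>For each \<open>t\<close> the balls of weight above \<open>t\<close> cover the
  superlevel set. Each ball is thus used for \<open>t\<close> up to its weight, and by Tonelli it
  contributes \<open>\<rho> powr \<beta>\<close> times that weight; the exponents of \<rho> add up
  to \<open>\<beta> + \<kappa> * p = \<delta>\<close>.\<close>

lemma choquet_integral_le_of_weighted_balls:
  fixes \<Omega> :: "'a::metric_space set" and I :: "(real \<times> 'a \<times> real) set"
  assumes I: "countable I" and nn: "\<forall>(h, y, \<rho>)\<in>I. 0 < h \<and> 0 \<le> \<rho>" and "0 \<le> M" "\<beta> + \<kappa> * p = \<delta>"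
    and cov: "\<And>x t. x \<in> \<Omega> \<Longrightarrow> 0 < t \<Longrightarrow> t < f x \<Longrightarrow> \<exists>(h, y, \<rho>)\<in>I. x \<in> ball y \<rho> \<and> t < M * (h * \<rho> powr \<kappa>) powr p"
  shows "choquet_integral \<beta> \<Omega> f \<le> ennreal M * (\<integral>\<^sup>+i. ennreal (fst i powr p * snd (snd i) powr \<delta>) \<partial>count_space I)"
proof -
  define w where "w = (\<lambda>i::real \<times> 'a \<times> real. M * (fst i * snd (snd i) powr \<kappa>) powr p)"
  have w: "0 \<le> w i" for i using \<open>0 \<le> M\<close> by (simp add: w_def)
  have pos: "0 < fst i" "0 \<le> snd (snd i)" if "i \<in> I" for i using nn that by (auto simp: split_beta)
  have "choquet_integral \<beta> \<Omega> f \<le> (\<integral>\<^sup>+t. (\<integral>\<^sup>+i. ennreal (snd (snd i) powr \<beta>) * indicator {0<..<w i} t \<partial>count_space I) \<partial>lborel)"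
    unfolding choquet_integral_def
  proof (intro nn_integral_mono)
    fix t :: real
    show "indicator {0<..} t * hausdorff_content \<beta> {x \<in> \<Omega>. t < f x}
      \<le> (\<integral>\<^sup>+i. ennreal (snd (snd i) powr \<beta>) * indicator {0<..<w i} t \<partial>count_space I)"
    proof (cases "0 < t")
      case True
      define It where "It = {i\<in>I. t < w i}"
      have "hausdorff_content \<beta> {x \<in> \<Omega>. t < f x} \<le> (\<integral>\<^sup>+i. ennreal (snd (snd i) powr \<beta>) \<partial>count_space It)"
      proof (rule hausdorff_content_le_countable_cover[where y = "\<lambda>i. fst (snd i)"])
        show "countable It" using I by (simp add: It_def)
        show "{x \<in> \<Omega>. t < f x} \<subseteq> (\<Union>i\<in>It. ball (fst (snd i)) (snd (snd i)))"
          using cov[OF _ True] by (force simp: It_def w_def)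
      qed (use pos in \<open>auto simp: It_def\<close>)
      also have "\<dots> = (\<integral>\<^sup>+i. ennreal (snd (snd i) powr \<beta>) * indicator {0<..<w i} t \<partial>count_space I)"
        using True by (simp add: nn_integral_count_space_indicator It_def)
          (auto intro!: nn_integral_cong split: split_indicator)
      finally show ?thesis using True by simp
    qed simp
  qed
  also have "\<dots> = (\<integral>\<^sup>+i. (\<integral>\<^sup>+t. ennreal (snd (snd i) powr \<beta>) * indicator {0<..<w i} t \<partial>lborel) \<partial>count_space I)"
    by (rule nn_integral_count_space_nn_integral[OF I]) auto
  also have "\<dots> = (\<integral>\<^sup>+i. ennreal M * ennreal (fst i powr p * snd (snd i) powr \<delta>) \<partial>count_space I)"
  proof (intro nn_integral_cong)
    fix i assume "i \<in> space (count_space I)"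
    then have i: "0 < fst i" "0 \<le> snd (snd i)" using pos by auto
    have "(\<integral>\<^sup>+t. ennreal (snd (snd i) powr \<beta>) * indicator {0<..<w i} t \<partial>lborel) = ennreal (snd (snd i) powr \<beta>) * ennreal (w i)"
      using w[of i] by (subst nn_integral_cmult_indicator) auto
    also have "\<dots> = ennreal (snd (snd i) powr \<beta> * w i)" using w[of i] by (simp add: ennreal_mult)
    also have "snd (snd i) powr \<beta> * w i = M * (fst i powr p * snd (snd i) powr \<delta>)"
    proof (cases "snd (snd i) = 0")
      case False
      then show ?thesis
        using i unfolding w_def \<open>\<beta> + \<kappa> * p = \<delta>\<close>[symmetric] by (simp add: powr_mult powr_powr powr_add mult_ac)
    qed simp
    also have "ennreal \<dots> = ennreal M * ennreal (fst i powr p * snd (snd i) powr \<delta>)"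
      using \<open>0 \<le> M\<close> by (rule ennreal_mult) simp
    finally show "(\<integral>\<^sup>+t. ennreal (snd (snd i) powr \<beta>) * indicator {0<..<w i} t \<partial>lborel) = ennreal M * ennreal (fst i powr p * snd (snd i) powr \<delta>)" .
  qed
  also have "\<dots> = ennreal M * (\<integral>\<^sup>+i. ennreal (fst i powr p * snd (snd i) powr \<delta>) \<partial>count_space I)"
    by (rule nn_integral_cmult) simp
  finally show ?thesis .
qed

lemma enn_powr_le_ennreal:
  assumes "x \<le> ennreal c" "0 \<le> c" "0 \<le> a"
  shows "enn_powr x a \<le> ennreal (c powr a)"
proof -
  from assms obtain y where y: "x = ennreal y" "0 \<le> y" "y \<le> c"
    by (cases x) (auto simp: top_unique)
  then show ?thesis using assms by (auto simp: enn_powr_def intro!: ennreal_leI powr_mono2)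
qed

theorem theorem4p7:
  fixes \<Omega> :: "'a::euclidean_space set"
    and s \<delta> p \<kappa> q :: real
  defines "n \<equiv> real DIM('a)"
  assumes "DIM('a) \<ge> 2"
    and "s_john_domain s \<Omega>"
    and "1 \<le> s" and "s < n / (n - 1)"
    and "0 < \<delta>" and "\<delta> \<le> n"
    and "\<delta> / n < p" and "p < \<delta> / (n + s * (1 - n))"
    and "0 \<le> \<kappa>" and "\<kappa> < n + s * (1 - n)"
    and "q = (\<delta> - \<kappa> * p) * p / (\<delta> - p * (n + s * (1 - n)))"
  shows "\<exists>c::real. 0 < c \<and>
    (\<forall>(u::'a \<Rightarrow> real) (g::'a \<Rightarrow> 'a).
       (\<forall>x\<in>\<Omega>. (u has_derivative (\<lambda>h. g x \<bullet> h)) (at x)) \<and> continuous_on \<Omega> g \<longrightarrow>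
       (INF b::real. enn_powr (choquet_integral (\<delta> - \<kappa> * p) \<Omega> (\<lambda>x. \<bar>u x - b\<bar> powr q)) (1 / q))
         \<le> ennreal c * enn_powr (choquet_integral \<delta> \<Omega> (\<lambda>x. norm (g x) powr p)) (1 / p))"
proof -
  define a where "a = n + s * (1 - n)"
  define \<beta> where "\<beta> = \<delta> - \<kappa> * p"
  have n2: "2 \<le> n" using assms(2) by (simp add: n_def)
  have "0 < \<delta> / n" using \<open>0 < \<delta>\<close> n2 by simp
  then have p: "0 < p" using assms by linarith
  have "s * (n - 1) < n" using assms(5) n2 by (simp add: pos_less_divide_eq)
  then have a: "0 < a" by (simp add: a_def algebra_simps)
  have pa: "p * a < \<delta>" using assms(9) a by (simp add: a_def[symmetric] pos_less_divide_eq)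
  have \<kappa>: "0 \<le> \<kappa>" "\<kappa> < a" using assms by (auto simp: a_def)
  have "\<kappa> * p < a * p" using \<kappa> p by (intro mult_strict_right_mono)
  then have \<beta>: "0 < \<beta>" using pa by (simp add: \<beta>_def mult.commute)
  have qdef: "q = \<beta> * p / (\<delta> - p * a)" using assms by (simp add: \<beta>_def a_def)
  have q: "0 < q" using \<beta> p pa by (simp add: qdef)
  \<comment> \<open>If \<open>h * r powr \<kappa> \<le> N\<close> and
    \<open>h * r powr (\<delta> / p) \<le> K\<close>, then \<open>h * r powr a\<close> is at most
    \<open>N * r powr \<alpha>\<close> and at most \<open>K * r powr - \<gamma>\<close>. Positivity
    of \<alpha> is \<open>\<kappa> < a\<close>, that of \<gamma> is \<open>p * a < \<delta>\<close>,
    and \<open>q\<close> is exactly the number with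
    \<open>\<gamma> / (\<alpha> + \<gamma>) = p / q\<close>.\<close>
  define \<alpha> where "\<alpha> = a - \<kappa>"
  define \<gamma> where "\<gamma> = \<delta> / p - a"
  have \<alpha>: "0 < \<alpha>" using \<kappa> by (simp add: \<alpha>_def)
  have \<gamma>: "0 < \<gamma>" using pa p by (simp add: \<gamma>_def field_simps)
  have sum\<alpha>\<gamma>: "\<alpha> + \<gamma> = \<beta> / p" using p by (simp add: \<alpha>_def \<gamma>_def \<beta>_def field_simps)
  have "\<gamma> / (\<beta> / p) = p / q"
    unfolding qdef \<gamma>_def using p \<beta> pa by (simp add: field_simps)
  then have \<gamma>pq: "\<gamma> / (\<alpha> + \<gamma>) = p / q" by (simp add: sum\<alpha>\<gamma>)
  define \<theta> where "\<theta> = \<alpha> / (\<alpha> + \<gamma>)"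
  have \<theta>: "\<theta> = 1 - p / q" unfolding \<theta>_def \<gamma>pq[symmetric] using \<alpha> \<gamma> by (simp add: field_simps)

  obtain C1 R :: real where C1: "0 < C1" and R: "0 < R" and john:
    "\<And>(u::'a \<Rightarrow> real) g. (\<And>x. x \<in> \<Omega> \<Longrightarrow> (u has_derivative (\<lambda>h. g x \<bullet> h)) (at x)) \<Longrightarrow> continuous_on \<Omega> g \<Longrightarrow>
       \<exists>b. \<forall>x\<in>\<Omega>. ennreal \<bar>u x - b\<bar> \<le> ennreal C1 * (\<Sum>j. ennreal ((R / 2 ^ j) powr (s * (1 - n))) *
          (\<integral>\<^sup>+y\<in>\<Omega> \<inter> ball x (R / 2 ^ j). ennreal (norm (g y)) \<partial>lborel))"
    using s_john_pointwise_estimate[OF assms(3), folded n_def] by blast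
  obtain C3 :: real where C3: "0 < C3" and fam:
    "\<And>(\<Omega>::'a set) f G R. (\<lambda>y. indicator \<Omega> y * f y) \<in> borel_measurable borel \<Longrightarrow>
      choquet_integral \<delta> \<Omega> (\<lambda>x. f x powr p) < ennreal G \<Longrightarrow>
      \<exists>I :: (real \<times> 'a \<times> real) set. countable I \<and> (\<forall>(h, y, \<rho>)\<in>I. 0 < h \<and> 0 \<le> \<rho>) \<and>
        (\<integral>\<^sup>+i. ennreal (fst i powr p * snd (snd i) powr \<delta>) \<partial>count_space I) \<le> ennreal (C3 * G) \<and>
        (\<forall>z r. 0 < r \<longrightarrow> r \<le> R \<longrightarrow> (\<integral>\<^sup>+y\<in>\<Omega> \<inter> ball z r. ennreal (f y) \<partial>lborel) \<noteq> 0 \<longrightarrow>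
          (\<exists>(h, y, \<rho>)\<in>I. z \<in> ball y \<rho> \<and> r \<le> \<rho> \<and>
             (\<integral>\<^sup>+y\<in>\<Omega> \<inter> ball z r. ennreal (f y) \<partial>lborel) \<le> ennreal (h * r powr n)))"
    using obtain_maximal_ball_family[where 'a = 'a and \<delta> = \<delta> and p = p, folded n_def, OF assms(6-8)] by blast
  obtain C4 :: real where C4: "0 < C4" and summin:
    "\<And>R N K. 0 < R \<Longrightarrow> 0 < N \<Longrightarrow> 0 < K \<Longrightarrow>
      (\<Sum>j. ennreal (min (N * (R / 2 ^ j) powr \<alpha>) (K * (R / 2 ^ j) powr - \<gamma>)))
      \<le> ennreal (C4 * (N powr (p / q) * K powr \<theta>))"
    by (rule suminf_min_powr_le[OF \<alpha> \<gamma>]) (simp add: \<gamma>pq \<theta>_def[symmetric])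
  define c where "c = C1 * C4 * C3 powr (1 / p)"
  have c: "0 < c" using C1 C4 C3 by (simp add: c_def)
  have "(INF b::real. enn_powr (choquet_integral \<beta> \<Omega> (\<lambda>x. \<bar>u x - b\<bar> powr q)) (1 / q))
         \<le> ennreal c * enn_powr (choquet_integral \<delta> \<Omega> (\<lambda>x. norm (g x) powr p)) (1 / p)"
    if der: "\<forall>x\<in>\<Omega>. (u has_derivative (\<lambda>h. g x \<bullet> h)) (at x)" and cg: "continuous_on \<Omega> g"
    for u :: "'a \<Rightarrow> real" and g :: "'a \<Rightarrow> 'a"
  proof -
    define F where "F = choquet_integral \<delta> \<Omega> (\<lambda>x. norm (g x) powr p)"
    define L where "L = (INF b::real. enn_powr (choquet_integral \<beta> \<Omega> (\<lambda>x. \<bar>u x - b\<bar> powr q)) (1 / q))"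
    have open\<Omega>: "open \<Omega>" using assms(3) by (simp add: s_john_domain_def)
    \<comment> \<open>A real \<open>G\<close> strictly above \<open>F\<close> covers
      \<open>F = 0\<close> too; \<open>F\<close> itself is reached by a limit at the end.\<close>
    have main: "L \<le> ennreal (c * G powr (1 / p))" if G: "F < ennreal G" for G
    proof -
      have G0: "0 < G" using G by (metis ennreal_neg not_le not_less_zero)
      have "\<exists>b. \<forall>x\<in>\<Omega>. ennreal \<bar>u x - b\<bar> \<le> ennreal C1 * (\<Sum>j. ennreal ((R / 2 ^ j) powr (s * (1 - n))) *
          (\<integral>\<^sup>+y\<in>\<Omega> \<inter> ball x (R / 2 ^ j). ennreal (norm (g y)) \<partial>lborel))"
        by (rule john) (use der cg in auto)
      then obtain b where b: "\<And>x. x \<in> \<Omega> \<Longrightarrow> ennreal \<bar>u x - b\<bar> \<le> ennreal C1 * (\<Sum>j. ennreal ((R / 2 ^ j) powr (s * (1 - n))) *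
          (\<integral>\<^sup>+y\<in>\<Omega> \<inter> ball x (R / 2 ^ j). ennreal (norm (g y)) \<partial>lborel))" by blast
      have "\<exists>I :: (real \<times> 'a \<times> real) set. countable I \<and> (\<forall>(h, y, \<rho>)\<in>I. 0 < h \<and> 0 \<le> \<rho>) \<and>
        (\<integral>\<^sup>+i. ennreal (fst i powr p * snd (snd i) powr \<delta>) \<partial>count_space I) \<le> ennreal (C3 * G) \<and>
        (\<forall>z r. 0 < r \<longrightarrow> r \<le> R \<longrightarrow> (\<integral>\<^sup>+y\<in>\<Omega> \<inter> ball z r. ennreal (norm (g y)) \<partial>lborel) \<noteq> 0 \<longrightarrow>
          (\<exists>(h, y, \<rho>)\<in>I. z \<in> ball y \<rho> \<and> r \<le> \<rho> \<and>
             (\<integral>\<^sup>+y\<in>\<Omega> \<inter> ball z r. ennreal (norm (g y)) \<partial>lborel) \<le> ennreal (h * r powr n)))"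
        using G unfolding F_def
        by (intro fam borel_measurable_indicator_times_continuous_on open\<Omega> continuous_on_norm cg) auto
      then obtain I :: "(real \<times> 'a \<times> real) set" where I: "countable I" and Inn: "\<forall>(h, y, \<rho>)\<in>I. 0 < h \<and> 0 \<le> \<rho>"
        and sumI: "(\<integral>\<^sup>+i. ennreal (fst i powr p * snd (snd i) powr \<delta>) \<partial>count_space I) \<le> ennreal (C3 * G)"
        and capt: "\<forall>z r. 0 < r \<longrightarrow> r \<le> R \<longrightarrow> (\<integral>\<^sup>+y\<in>\<Omega> \<inter> ball z r. ennreal (norm (g y)) \<partial>lborel) \<noteq> 0 \<longrightarrow>
          (\<exists>(h, y, \<rho>)\<in>I. z \<in> ball y \<rho> \<and> r \<le> \<rho> \<and>
             (\<integral>\<^sup>+y\<in>\<Omega> \<inter> ball z r. ennreal (norm (g y)) \<partial>lborel) \<le> ennreal (h * r powr n))"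
        by (elim exE conjE) (rule that)
      define K where "K = (C3 * G) powr (1 / p)"
      have K: "0 < K" using C3 G0 by (simp add: K_def)
      have hedberg: "\<bar>u x - b\<bar> \<le> C1 * C4 * (N powr (p / q) * K powr \<theta>)"
        if x: "x \<in> \<Omega>" and N: "0 < N" and sup: "\<And>h y \<rho>. (h, y, \<rho>) \<in> I \<Longrightarrow> x \<in> ball y \<rho> \<Longrightarrow> h * \<rho> powr \<kappa> \<le> N" for x N
      proof -
        define J where "J = (\<lambda>r. (\<integral>\<^sup>+y\<in>\<Omega> \<inter> ball x r. ennreal (norm (g y)) \<partial>lborel))"
        have Jr: "ennreal (r powr (s * (1 - n))) * J r \<le> ennreal (min (N * r powr \<alpha>) (K * r powr - \<gamma>))"
          if r: "0 < r" "r \<le> R" for r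
        proof (cases "J r = 0")
          case False
          then obtain h y \<rho> where i: "(h, y, \<rho>) \<in> I" "x \<in> ball y \<rho>" "r \<le> \<rho>" "J r \<le> ennreal (h * r powr n)"
            using capt r unfolding J_def by fastforce
          have h: "0 < h" using Inn i(1) by auto
          have "h * r powr \<kappa> \<le> h * \<rho> powr \<kappa>" using h r i(3) \<kappa> by (intro mult_left_mono powr_mono2) auto
          also have "\<dots> \<le> N" by (rule sup[OF i(1,2)])
          finally have h1: "h \<le> N * r powr - \<kappa>" using r by (simp add: powr_minus field_simps)
          have "h powr p * r powr \<delta> \<le> h powr p * \<rho> powr \<delta>"
            using r i(3) \<open>0 < \<delta>\<close> by (intro mult_left_mono powr_mono2) auto
          \<comment> \<open>The bound of order \<open>\<delta> / p\<close> comes from a single term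
            of the weighted sum.\<close>
          also have "ennreal (h powr p * \<rho> powr \<delta>) \<le> ennreal (C3 * G)"
            using nn_integral_count_space_ge_point[OF i(1), of "\<lambda>i. ennreal (fst i powr p * snd (snd i) powr \<delta>)"] sumI
            by (auto intro: order_trans)
          then have "h powr p * \<rho> powr \<delta> \<le> C3 * G" using C3 G0 by (subst (asm) ennreal_le_iff) auto
          finally have "(h powr p * r powr \<delta>) powr (1 / p) \<le> K"
            unfolding K_def using p by (intro powr_mono2) auto
          then have "h * r powr (\<delta> / p) \<le> K" using h r p by (simp add: powr_mult powr_powr)
          then have h2: "h \<le> K * r powr - (\<delta> / p)" using r by (simp add: powr_minus field_simps)
          have "ennreal (r powr (s * (1 - n))) * J r \<le> ennreal (r powr (s * (1 - n))) * ennreal (h * r powr n)"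
            by (intro mult_left_mono i(4)) simp
          also have "\<dots> = ennreal (h * r powr a)"
            using h r by (simp add: ennreal_mult[symmetric] a_def powr_add mult_ac)
          also have "\<dots> \<le> ennreal (min (N * r powr \<alpha>) (K * r powr - \<gamma>))"
          proof (intro ennreal_leI min.boundedI)
            have "h * r powr a \<le> N * r powr - \<kappa> * r powr a" using h1 by (intro mult_right_mono) auto
            then show "h * r powr a \<le> N * r powr \<alpha>" using r by (simp add: \<alpha>_def powr_diff powr_minus field_simps)
            have "h * r powr a \<le> K * r powr - (\<delta> / p) * r powr a" using h2 by (intro mult_right_mono) auto
            then show "h * r powr a \<le> K * r powr - \<gamma>" using r by (simp add: \<gamma>_def powr_diff powr_minus field_simps)
          qed
          finally show ?thesis .
        qed simp
        have "ennreal \<bar>u x - b\<bar> \<le> ennreal C1 * (\<Sum>j. ennreal ((R / 2 ^ j) powr (s * (1 - n))) * J (R / 2 ^ j))"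
          using b[OF x] by (simp add: J_def)
        also have "\<dots> \<le> ennreal C1 * (\<Sum>j. ennreal (min (N * (R / 2 ^ j) powr \<alpha>) (K * (R / 2 ^ j) powr - \<gamma>)))"
        proof (intro mult_left_mono suminf_le Jr)
          fix j :: nat
          have "R / 2 ^ j \<le> R / 1" using R by (intro divide_left_mono) auto
          then show "R / 2 ^ j \<le> R" by simp
        qed (use R in auto)
        also have "\<dots> \<le> ennreal C1 * ennreal (C4 * (N powr (p / q) * K powr \<theta>))"
          by (intro mult_left_mono summin R N K) simp
        also have "\<dots> = ennreal (C1 * C4 * (N powr (p / q) * K powr \<theta>))"
          using C1 C4 by (simp add: ennreal_mult[symmetric] mult_ac)
        finally show ?thesis using C1 C4 by (subst (asm) ennreal_le_iff) auto
      qed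
      define D where "D = C1 * C4 * K powr \<theta>"
      have D: "0 < D" using C1 C4 K by (simp add: D_def)
      define M where "M = D powr q"
      have M: "0 < M" using D by (simp add: M_def)
      have "choquet_integral \<beta> \<Omega> (\<lambda>x. \<bar>u x - b\<bar> powr q) \<le> ennreal M * (\<integral>\<^sup>+i. ennreal (fst i powr p * snd (snd i) powr \<delta>) \<partial>count_space I)"
      proof (rule choquet_integral_le_of_weighted_balls[OF I Inn, where \<kappa> = \<kappa>])
        fix x t assume x: "x \<in> \<Omega>" and t: "0 < t" "t < \<bar>u x - b\<bar> powr q"
        \<comment> \<open>Chosen so that \<open>M * N powr p = t\<close>: if no ball at
          \<open>x\<close> had weight above \<open>t\<close>, the estimate \<open>hedberg\<close>
          would give \<open>|u x - b| powr q \<le> M * N powr p = t\<close>.\<close>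
        define N where "N = (t / M) powr (1 / p)"
        have N: "0 < N" using t M by (simp add: N_def)
        have Np: "N powr p = t / M" using t M p by (simp add: N_def powr_powr)
        show "\<exists>(h, y, \<rho>)\<in>I. x \<in> ball y \<rho> \<and> t < M * (h * \<rho> powr \<kappa>) powr p"
        proof (rule ccontr)
          assume neg: "\<not> ?thesis"
          have "h * \<rho> powr \<kappa> \<le> N" if i: "(h, y, \<rho>) \<in> I" "x \<in> ball y \<rho>" for h y \<rho>
          proof (rule ccontr)
            assume "\<not> h * \<rho> powr \<kappa> \<le> N"
            then have "N powr p < (h * \<rho> powr \<kappa>) powr p" using N p by (intro powr_less_mono2) auto
            then have "t < M * (h * \<rho> powr \<kappa>) powr p" using M by (simp add: Np field_simps)
            then show False using neg i by blast
          qed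
          from hedberg[OF x N this] have "\<bar>u x - b\<bar> \<le> D * N powr (p / q)" by (simp add: D_def mult_ac)
          then have "\<bar>u x - b\<bar> powr q \<le> (D * N powr (p / q)) powr q" using q by (intro powr_mono2) auto
          also have "\<dots> = M * N powr p" using D N q by (simp add: powr_mult powr_powr M_def)
          also have "\<dots> = t" using M by (simp add: Np)
          finally show False using t by simp
        qed
      qed (use M in \<open>auto simp: \<beta>_def\<close>)
      also have "\<dots> \<le> ennreal M * ennreal (C3 * G)" by (intro mult_left_mono sumI) simp
      also have "\<dots> = ennreal (M * (C3 * G))" using M C3 G0 by (simp add: ennreal_mult)
      finally have "enn_powr (choquet_integral \<beta> \<Omega> (\<lambda>x. \<bar>u x - b\<bar> powr q)) (1 / q) \<le> ennreal ((M * (C3 * G)) powr (1 / q))"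
        using M C3 G0 q by (intro enn_powr_le_ennreal) auto
      also have "(M * (C3 * G)) powr (1 / q) = c * G powr (1 / p)"
      proof -
        have "(M * (C3 * G)) powr (1 / q) = D * (C3 * G) powr (1 / q)"
          unfolding M_def using C3 G0 q D by (subst powr_mult) (auto simp: powr_powr)
        also have "\<dots> = C1 * C4 * ((C3 * G) powr (1 / p * \<theta>) * (C3 * G) powr (1 / q))"
          by (simp add: D_def K_def powr_powr)
        also have "(C3 * G) powr (1 / p * \<theta>) * (C3 * G) powr (1 / q) = (C3 * G) powr (1 / p)"
        proof -
          \<comment> \<open>The powers of \<open>C3 * G\<close> from \<open>K powr \<theta>\<close>
            and from the sum over the family combine to \<open>1 / p\<close>, because
            \<open>\<theta> = 1 - p / q\<close>.\<close>
          have "1 / p * \<theta> + 1 / q = 1 / p" using p q by (simp add: \<theta> field_simps)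
          then show ?thesis by (simp only: powr_add[symmetric])
        qed
        finally show ?thesis using C3 G0 by (simp add: c_def powr_mult)
      qed
      finally show ?thesis unfolding L_def by (rule INF_lower2[OF UNIV_I])
    qed
    have "L \<le> ennreal c * enn_powr F (1 / p)"
    proof (cases "F = \<infinity>")
      case True
      then show ?thesis using c by (simp add: enn_powr_def ennreal_mult_top)
    next
      case False
      then obtain \<phi> where \<phi>: "F = ennreal \<phi>" "0 \<le> \<phi>" by (cases F) auto
      \<comment> \<open>The shift by \<open>1 / (k + 1)\<close> keeps \<open>G\<close> strictly
        above \<phi>, as \<open>main\<close> requires, and continuity of the power removes it, also
        at \<open>\<phi> = 0\<close>.\<close>
      have "(\<lambda>k. ennreal (c * (\<phi> + inverse (real (Suc k))) powr (1 / p))) \<longlonglongrightarrow> ennreal (c * (\<phi> + 0) powr (1 / p))"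
        using p \<phi>(2)
        by (intro tendsto_ennrealI tendsto_mult tendsto_const tendsto_powr2 tendsto_add LIMSEQ_inverse_real_of_nat always_eventually) auto
      then have "L \<le> ennreal (c * (\<phi> + 0) powr (1 / p))"
      proof (rule LIMSEQ_le_const)
        show "\<exists>N. \<forall>k\<ge>N. L \<le> ennreal (c * (\<phi> + inverse (real (Suc k))) powr (1 / p))"
          using \<phi> by (intro exI allI impI main) (auto simp: ennreal_less_iff)
      qed
      also have "\<dots> = ennreal c * enn_powr F (1 / p)"
        using \<phi> c by (simp add: enn_powr_def ennreal_mult)
      finally show ?thesis .
    qed
    then show ?thesis by (simp add: L_def F_def)
  qed
  then show ?thesis using c unfolding \<beta>_def by blast
qed

end
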